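(* Let $\mathbb K$ be a field of characteristic zero and let $\mathfrak m_0$ be the $\mathbb N$-graded Lie algebra over $\mathbb K$ with basis $e_1,e_2,\dots$ and nontrivial brackets $[e_1,e_i]=e_{i+1}$ for all $i\ge 2$. The bigraded cohomology algebra $H^*(\mathfrak m_0)=\bigoplus_{k,q}H^q_k(\mathfrak m_0)$ (trivial coefficients) is spanned by the cohomology classes of the following homogeneous cocycles: $$e^1,\quad e^2,\quad \omega(e^{i_1}\wedge\dots\wedge e^{i_q}\wedge e^{i_q+1})=\sum_{l\ge 0}(-1)^l D_1^l(e^{i_1}\wedge e^{i_2}\wedge\dots\wedge e^{i_q})\wedge e^{i_q+1+l},$$ where $q\ge 1$, $2\le i_1<i_2<\dots<i_q$; in particular $$\dim H^q_{k+\frac{q(q+1)}{2}}(\mathfrak m_0)=P_q(k)-P_q(k-1).$$ The multiplicative structure is defined by $$[e^1]\wedge\omega(\xi\wedge e^i\wedge e^{i+1})=0,\qquad [e^2]\wedge\omega(\xi\wedge e^i\wedge e^{i+1})=\omega(e^2\wedge\xi\wedge e^i\wedge e^{i+1}),$$ $$\begin{aligned} &\omega(\xi\wedge e^i\wedge e^{i+1})\wedge\omega(\eta\wedge e^j\wedge e^{j+1}) =\sum_{l=0}^{j-i+1}(-1)^l\,\omega\big(D_1^l(\xi\wedge e^i)\wedge e^{i+1+l}\wedge\eta\wedge e^j\wedge e^{j+1}\big)\\ &\quad+(-1)^{j-i+\deg\eta}\sum_{s\ge1}\omega\big(D_1^{j-i-1+s}(\xi\wedge e^i)\wedge D_1^s(\eta\wedge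 e^j)\wedge e^{j+s}\wedge e^{j+s+1}\big)\\ &\quad+(-1)^{j-i+\deg\eta+1}\sum_{s\ge1}\omega\big(D_1^{j-i+1+s}(\xi\wedge e^i)\wedge D_1^s(\eta\wedge e^j)\wedge e^{j+s+1}\wedge e^{j+s+2}\big), \end{aligned}$$ where $i\le j$, and $\xi$ and $\eta$ are arbitrary homogeneous forms in $\Lambda^*(e^2,\dots,e^{i-1})$ and $\Lambda^*(e^2,\dots,e^{j-1})$, respectively.
   Context: $e^1,e^2,\dots$ are the 1-forms dual to $e_1,e_2,\dots$. The cochain complex of $\mathfrak m_0$ consists of (formal series of) exterior forms in $e^1,e^2,\dots$, with differential satisfying $d(\rho\wedge\eta)=d\rho\wedge\eta+(-1)^{\deg\rho}\rho\wedge d\eta$ and dual to the bracket on 1-forms: $de^1=de^2=0$, $de^i=e^1\wedge e^{i-1}$ for $i\ge3$. $\Lambda^q_k$ is the finite-dimensional span of the monomials $e^{i_1}\wedge\dots\wedge e^{i_q}$ with $i_1<\dots<i_q$ and $i_1+\dots+i_q=k$ ($k$ is called the second grading); $d\Lambda^q_k\subset\Lambda^{q+1}_k$, and $H^q_k(\mathfrak m_0)$ is the degree-$q$ cohomology of $(\Lambda^*_k,d)$. The exterior product induces products $H^q_k\otimes H^p_l\to H^{q+p}_{k+l}$. $D_1=(\mathrm{ad}\,e_1)^*$ is the degree-0 derivation of $\Lambda^*(e^2,e^3,\dots)$ with $D_1(e^2)=0$, $D_1(e^i)=e^{i-1}$ for $i\ge3$, and $D_1(\xi\wedge\eta)=D_1(\xi)\wedge\eta+\xi\wedge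 D_1(\eta)$. All sums above are finite. $\omega$ is extended linearly to the span of all monomials $e^{i_1}\wedge\dots\wedge e^{i_q}\wedge e^{i_q+1}$, $2\le i_1<\dots<i_q$ (monomials whose two largest superscripts are consecutive); a form to which $\omega$ is applied is first expanded in monomials with increasing superscripts. $\omega(\cdot)$ also denotes the cohomology class of the corresponding cocycle. $P_q(N)$ is the number of partitions of $N$ into $q$ parts, i.e. the number of solutions of $N=x_1+\dots+x_q$ in integers $1\le x_1\le\dots\le x_q$.
   Formalization: The unit class 1 (spanning H^0) is added to the listed spanning cocycles, and the dimension formula is stated for q ≥ 1 except at q=1, k=0, where it fails: H^1_1 is spanned by [e^1] but P_1(0)-P_1(-1)=0. *)

theory Defs
  imports "HOL.Vector_Spaces" "HOL-Library.Groups_Big_Fun"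
begin

text \<open>Elements are coordinate functions with respect to $e_1, e_2, \dots$; the index 0 is unused.\<close>

definition m0 :: "(nat \<Rightarrow> 'k::field) set" where
  "m0 = {x. finite {i. x i \<noteq> 0} \<and> x 0 = 0}"

definition basis_vec :: "nat \<Rightarrow> nat \<Rightarrow> 'k::field" where
  "basis_vec i = (\<lambda>j. if j = i then 1 else 0)"

definition bracket :: "(nat \<Rightarrow> 'k::field) \<Rightarrow> (nat \<Rightarrow> 'k) \<Rightarrow> nat \<Rightarrow> 'k" where
  "bracket x y = (\<lambda>k. if k \<ge> 3 then x 1 * y (k - 1) - y 1 * x (k - 1) else 0)"

lemma basis_vec_in_m0: "i \<ge> 1 \<Longrightarrow> basis_vec i \<in> m0"
  by (auto simp: m0_def basis_vec_def)

lemma bracket_in_m0: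
  assumes "x \<in> m0" "y \<in> m0"
  shows "bracket x y \<in> m0"
proof -
  have "{k. bracket x y k \<noteq> 0} \<subseteq> Suc ` {i. x i \<noteq> 0} \<union> Suc ` {i. y i \<noteq> 0}"
  proof
    fix k assume "k \<in> {k. bracket x y k \<noteq> 0}"
    then have "k \<ge> 3" "x (k - 1) \<noteq> 0 \<or> y (k - 1) \<noteq> 0"
      by (auto simp: bracket_def split: if_splits)
    then show "k \<in> Suc ` {i. x i \<noteq> 0} \<union> Suc ` {i. y i \<noteq> 0}"
      by (auto simp: image_iff intro!: exI[of _ "k - 1"])
  qed
  moreover have "finite (Suc ` {i. x i \<noteq> 0} \<union> Suc ` {i. y i \<noteq> 0})"
    using assms by (simp add: m0_def)
  ultimately have "finite {k. bracket x y k \<noteq> 0}" by (rule finite_subset)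
  then show ?thesis by (simp add: m0_def bracket_def)
qed

lemma bracket_basis_1: "i \<ge> 2 \<Longrightarrow> bracket (basis_vec 1) (basis_vec i) = basis_vec (i + 1)"
  by (auto simp: bracket_def basis_vec_def fun_eq_iff)

lemma bracket_basis_other: "i \<noteq> 1 \<Longrightarrow> j \<noteq> 1 \<Longrightarrow> bracket (basis_vec i) (basis_vec j) = (\<lambda>_. 0)"
  by (auto simp: bracket_def basis_vec_def fun_eq_iff)

lemma bracket_self: "bracket x x = (\<lambda>_. 0)"
  by (auto simp: bracket_def fun_eq_iff)

lemma bracket_anti: "bracket x y k = - bracket y x k"
  by (auto simp: bracket_def)

lemma bracket_linear:
  "bracket x (\<lambda>i. c * y i + z i) k = c * bracket x y k + bracket x z k"
  by (auto simp: bracket_def algebra_simps)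

lemma bracket_jacobi:
  "bracket x (bracket y z) k + bracket y (bracket z x) k + bracket z (bracket x y) k = 0"
  by (auto simp: bracket_def algebra_simps)

text \<open>A finite exterior form in $e^1, e^2, \dots$ is given by its coefficients on the monomials with
  increasing superscripts; such a monomial is identified with its set of superscripts.\<close>

typedef (overloaded) 'k form =
  "{f :: nat set \<Rightarrow> 'k::field. finite {I. f I \<noteq> 0} \<and> (\<forall>I. f I \<noteq> 0 \<longrightarrow> finite I \<and> 0 \<notin> I)}"
  morphisms coeff Abs_form
  by (rule exI[of _ "\<lambda>_. 0"]) auto

setup_lifting type_definition_form

lemma finite_support [simp]: "finite {I. coeff a I \<noteq> 0}"
  using coeff[of a] by simp

lemma coeff_infinite: "infinite I \<or> 0 \<in> I \<Longrightarrow> coeff a I = 0"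
  using coeff[of a] by auto

lemma form_eqI: "(\<And>I. finite I \<Longrightarrow> 0 \<notin> I \<Longrightarrow> coeff a I = coeff b I) \<Longrightarrow> a = b"
  by (metis coeff_inject coeff_infinite ext)

instantiation form :: (field) ab_group_add
begin

lift_definition zero_form :: "'a form" is "\<lambda>_. 0" by simp

lift_definition plus_form :: "'a form \<Rightarrow> 'a form \<Rightarrow> 'a form" is "\<lambda>f g I. f I + g I"
proof -
  fix f g :: "nat set \<Rightarrow> 'a"
  assume *: "finite {I. f I \<noteq> 0} \<and> (\<forall>I. f I \<noteq> 0 \<longrightarrow> finite I \<and> 0 \<notin> I)"
    "finite {I. g I \<noteq> 0} \<and> (\<forall>I. g I \<noteq> 0 \<longrightarrow> finite I \<and> 0 \<notin> I)"
  have "{I. f I + g I \<noteq> 0} \<subseteq> {I. f I \<noteq> 0} \<union> {I. g I \<noteq> 0}" by auto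
  with * show "finite {I. f I + g I \<noteq> 0} \<and> (\<forall>I. f I + g I \<noteq> 0 \<longrightarrow> finite I \<and> 0 \<notin> I)"
    by (metis (mono_tags, lifting) add.right_neutral finite_Un finite_subset)
qed

lift_definition uminus_form :: "'a form \<Rightarrow> 'a form" is "\<lambda>f I. - f I" by simp

definition minus_form :: "'a form \<Rightarrow> 'a form \<Rightarrow> 'a form" where "minus_form a b = a + - b"

instance
  by standard (auto intro!: form_eqI
    simp: plus_form.rep_eq zero_form.rep_eq uminus_form.rep_eq minus_form_def algebra_simps)

end

lemma coeff_zero [simp]: "coeff 0 I = 0" by transfer simp
lemma coeff_add [simp]: "coeff (a + b) I = coeff a I + coeff b I" by transfer simp
lemma coeff_uminus [simp]: "coeff (- a) I = - coeff a I" by transfer simp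
lemma coeff_minus [simp]: "coeff (a - b) I = coeff a I - coeff b I"
  unfolding minus_form_def coeff_add coeff_uminus by simp
lemma coeff_sum [simp]: "coeff (sum f A) I = (\<Sum>x\<in>A. coeff (f x) I)"
  by (induction A rule: infinite_finite_induct) auto

lift_definition scale_form :: "'k::field \<Rightarrow> 'k form \<Rightarrow> 'k form"  (infixr \<open>*\<^sub>F\<close> 75)
  is "\<lambda>c f I. c * f I"
  by (auto elim: rev_finite_subset)

lemma coeff_scale [simp]: "coeff (c *\<^sub>F a) I = c * coeff a I" by transfer simp

global_interpretation form: vector_space "scale_form :: 'k::field \<Rightarrow> 'k form \<Rightarrow> 'k form"
  by standard (auto intro!: form_eqI simp: algebra_simps)

text \<open>The monomial $e^{i_1} \wedge \dots \wedge e^{i_q}$, $i_1 < \dots < i_q$, for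
  $I = \{i_1, \dots, i_q\}$.\<close>

lift_definition monom :: "nat set \<Rightarrow> 'k::field form"
  is "\<lambda>I J. if J = I \<and> finite I \<and> 0 \<notin> I then 1 else 0"
  by (auto split: if_splits)

abbreviation e :: "nat \<Rightarrow> 'k::field form" where "e i \<equiv> monom {i}"

lemma coeff_monom: "coeff (monom I) J = (if J = I \<and> finite I \<and> 0 \<notin> I then 1 else 0)"
  by transfer simp

lemma monom_eq_0: "infinite I \<or> 0 \<in> I \<Longrightarrow> monom I = 0"
  by (rule form_eqI) (auto simp: coeff_monom)

text \<open>The sign of the permutation sorting the concatenation of (increasing) $I$ and $J$.\<close>

definition shuffle_sign :: "nat set \<Rightarrow> nat set \<Rightarrow> 'k::field" where
  "shuffle_sign I J = (-1) ^ card {(i, j). i \<in> I \<and> j \<in> J \<and> j < i}"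

lemma finite_inv: "finite I \<Longrightarrow> finite J \<Longrightarrow> finite {(i, j). i \<in> I \<and> j \<in> J \<and> j < i}"
  by (rule finite_subset[of _ "I \<times> J"]) auto

lemma shuffle_sign_Un_right:
  assumes "finite I" "finite J" "finite L" "J \<inter> L = {}"
  shows "shuffle_sign I (J \<union> L) = shuffle_sign I J * shuffle_sign I L"
proof -
  have "{(i, j). i \<in> I \<and> j \<in> J \<union> L \<and> j < i} =
    {(i, j). i \<in> I \<and> j \<in> J \<and> j < i} \<union> {(i, j). i \<in> I \<and> j \<in> L \<and> j < i}" by auto
  then have "card {(i, j). i \<in> I \<and> j \<in> J \<union> L \<and> j < i} =
    card {(i, j). i \<in> I \<and> j \<in> J \<and> j < i} + card {(i, j). i \<in> I \<and> j \<in> L \<and> j < i}"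
    using assms by (simp, subst card_Un_disjoint) (auto intro: finite_inv)
  then show ?thesis unfolding shuffle_sign_def by (simp only: power_add)
qed

lemma shuffle_sign_Un_left:
  assumes "finite I" "finite J" "finite L" "J \<inter> L = {}"
  shows "shuffle_sign (J \<union> L) I = shuffle_sign J I * shuffle_sign L I"
proof -
  have "{(i, j). i \<in> J \<union> L \<and> j \<in> I \<and> j < i} =
    {(i, j). i \<in> J \<and> j \<in> I \<and> j < i} \<union> {(i, j). i \<in> L \<and> j \<in> I \<and> j < i}" by auto
  then have "card {(i, j). i \<in> J \<union> L \<and> j \<in> I \<and> j < i} =
    card {(i, j). i \<in> J \<and> j \<in> I \<and> j < i} + card {(i, j). i \<in> L \<and> j \<in> I \<and> j < i}"
    using assms by (simp, subst card_Un_disjoint) (auto intro: finite_inv)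
  then show ?thesis unfolding shuffle_sign_def by (simp only: power_add)
qed

lemma shuffle_sign_empty [simp]: "shuffle_sign {} I = 1" "shuffle_sign I {} = 1"
  by (simp_all add: shuffle_sign_def)

text \<open>The exterior product is written \<open>*\<close>; see \<open>monom_mult\<close> for its values on monomials.\<close>

instantiation form :: (field) ring_1
begin

definition one_form :: "'a form" where "one_form = monom {}"

lift_definition times_form :: "'a form \<Rightarrow> 'a form \<Rightarrow> 'a form"
  is "\<lambda>f g K. \<Sum>I\<in>Pow K. shuffle_sign I (K - I) * f I * g (K - I)"
proof -
  fix f g :: "nat set \<Rightarrow> 'a"
  assume f: "finite {I. f I \<noteq> 0} \<and> (\<forall>I. f I \<noteq> 0 \<longrightarrow> finite I \<and> 0 \<notin> I)"
    and g: "finite {I. g I \<noteq> 0} \<and> (\<forall>I. g I \<noteq> 0 \<longrightarrow> finite I \<and> 0 \<notin> I)"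
  define h where "h = (\<lambda>K. \<Sum>I\<in>Pow K. shuffle_sign I (K - I) * f I * g (K - I))"
  have *: "\<exists>I. I \<subseteq> K \<and> f I \<noteq> 0 \<and> g (K - I) \<noteq> 0" if "h K \<noteq> 0" for K
  proof (rule ccontr)
    assume "\<not> ?thesis"
    then have "h K = 0" unfolding h_def by (intro sum.neutral) auto
    with that show False by simp
  qed
  have sub: "{K. h K \<noteq> 0} \<subseteq> (\<lambda>(I, J). I \<union> J) ` ({I. f I \<noteq> 0} \<times> {I. g I \<noteq> 0})"
  proof
    fix K assume "K \<in> {K. h K \<noteq> 0}"
    with * obtain I where "I \<subseteq> K" "f I \<noteq> 0" "g (K - I) \<noteq> 0" by blast
    then show "K \<in> (\<lambda>(I, J). I \<union> J) ` ({I. f I \<noteq> 0} \<times> {I. g I \<noteq> 0})"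
      by (auto intro!: rev_image_eqI[of "(I, K - I)"])
  qed
  have "finite {K. h K \<noteq> 0}"
    using f g by (intro finite_subset[OF sub]) auto
  moreover have "finite K \<and> 0 \<notin> K" if "h K \<noteq> 0" for K
    using sub that f g by auto
  ultimately show "finite {K. h K \<noteq> 0} \<and> (\<forall>K. h K \<noteq> 0 \<longrightarrow> finite K \<and> 0 \<notin> K)"
    by blast
qed

lemma coeff_times: "coeff (a * b) K = (\<Sum>I\<in>Pow K. shuffle_sign I (K - I) * coeff a I * coeff b (K - I))"
  by transfer simp

instance
proof
  fix a b c :: "'a form"
  show "a * b * c = a * (b * c)"
  proof (rule form_eqI)
    fix K :: "nat set" assume K: "finite K" "0 \<notin> K"
    have "coeff (a * b * c) K = (\<Sum>I\<in>Pow K. \<Sum>J\<in>Pow I. shuffle_sign I (K - I) * shuffle_sign J (I - J)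
        * coeff a J * coeff b (I - J) * coeff c (K - I))"
      by (simp add: coeff_times sum_distrib_left sum_distrib_right mult_ac)
    also have "\<dots> = (\<Sum>(I, J)\<in>(SIGMA I:Pow K. Pow I). shuffle_sign I (K - I) * shuffle_sign J (I - J)
        * coeff a J * coeff b (I - J) * coeff c (K - I))"
      using K by (subst sum.Sigma) (auto intro: finite_subset)
    also have "\<dots> = (\<Sum>(J, M)\<in>(SIGMA J:Pow K. Pow (K - J)). shuffle_sign J (K - J) *
        shuffle_sign M (K - J - M) * coeff a J * coeff b M * coeff c (K - J - M))"
    proof (rule sum.reindex_bij_witness[of _ "\<lambda>(J, M). (J \<union> M, J)" "\<lambda>(I, J). (J, I - J)"])
      fix p assume "p \<in> (SIGMA I:Pow K. Pow I)"
      then obtain I J where p: "p = (I, J)" "J \<subseteq> I" "I \<subseteq> K" by auto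
      define M L where "M = I - J" and "L = K - I"
      have fin: "finite J" "finite M" "finite L"
        using p K by (auto simp: M_def L_def intro: finite_subset)
      have eqs: "I = J \<union> M" "K - J = M \<union> L" "K - J - M = L"
        and dis: "J \<inter> M = {}" "M \<inter> L = {}"
        using p by (auto simp: M_def L_def)
      have "shuffle_sign I L * shuffle_sign J M =
          (shuffle_sign J (K - J) * shuffle_sign M L :: 'a)"
        unfolding eqs using fin dis
        by (subst shuffle_sign_Un_left) (auto simp: shuffle_sign_Un_right mult_ac)
      then show "(case case p of (I, J) \<Rightarrow> (J, I - J) of (J, M) \<Rightarrow> shuffle_sign J (K - J) *
          shuffle_sign M (K - J - M) * coeff a J * coeff b M * coeff c (K - J - M)) =
        (case p of (I, J) \<Rightarrow> shuffle_sign I (K - I) * shuffle_sign J (I - J)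
          * coeff a J * coeff b (I - J) * coeff c (K - I))"
        using p eqs(3) by (simp add: M_def[symmetric] L_def[symmetric])
    qed auto
    also have "\<dots> = (\<Sum>J\<in>Pow K. \<Sum>M\<in>Pow (K - J). shuffle_sign J (K - J) *
        shuffle_sign M (K - J - M) * coeff a J * coeff b M * coeff c (K - J - M))"
      using K by (subst sum.Sigma) (auto intro: finite_subset)
    also have "\<dots> = coeff (a * (b * c)) K"
      by (simp add: coeff_times sum_distrib_left sum_distrib_right mult_ac)
    finally show "coeff (a * b * c) K = coeff (a * (b * c)) K" .
  qed
  show "1 * a = a"
  proof (rule form_eqI)
    fix K :: "nat set" assume K: "finite K" "0 \<notin> K"
    have "coeff (1 * a) K = (\<Sum>I\<in>{{}}. shuffle_sign I (K - I) * coeff 1 I * coeff a (K - I))"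
      unfolding coeff_times using K
      by (intro sum.mono_neutral_right) (auto simp: one_form_def coeff_monom)
    then show "coeff (1 * a) K = coeff a K" by (simp add: one_form_def coeff_monom)
  qed
  show "a * 1 = a"
  proof (rule form_eqI)
    fix K :: "nat set" assume K: "finite K" "0 \<notin> K"
    have "coeff (a * 1) K = (\<Sum>I\<in>{K}. shuffle_sign I (K - I) * coeff a I * coeff 1 (K - I))"
      unfolding coeff_times using K
      by (intro sum.mono_neutral_right) (auto simp: one_form_def coeff_monom)
    then show "coeff (a * 1) K = coeff a K" by (simp add: one_form_def coeff_monom)
  qed
  show "(a + b) * c = a * c + b * c" "a * (b + c) = a * b + a * c"
    by (auto intro!: form_eqI simp: coeff_times algebra_simps sum.distrib)
  have "coeff (1 :: 'a form) {} \<noteq> coeff 0 {}" by (simp add: one_form_def coeff_monom)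
  then show "(0 :: 'a form) \<noteq> 1" by metis
qed

end

lemma scale_mult_left [simp]: "(c *\<^sub>F a) * b = c *\<^sub>F (a * b)"
  by (auto intro!: form_eqI simp: coeff_times sum_distrib_left mult_ac)

lemma scale_mult_right [simp]: "a * (c *\<^sub>F b) = c *\<^sub>F (a * b)"
  by (auto intro!: form_eqI simp: coeff_times sum_distrib_left mult_ac)

lemma monom_empty: "monom {} = 1"
  by (simp add: one_form_def)

lemma monom_mult:
  assumes "finite I" "finite J"
  shows "monom I * monom J =
    (if I \<inter> J = {} then shuffle_sign I J *\<^sub>F monom (I \<union> J) else (0 :: 'k::field form))"
proof (cases "0 \<in> I \<or> 0 \<in> J")
  case True
  then show ?thesis by (auto simp: monom_eq_0)
next
  case False
  show ?thesis
  proof (rule form_eqI)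
    fix K :: "nat set" assume K: "finite K" "0 \<notin> K"
    have "coeff (monom I * monom J :: 'k form) K =
      (\<Sum>L\<in>Pow K. if L = I then (if K - I = J then shuffle_sign I J else 0) else 0)"
      unfolding coeff_times using False assms by (intro sum.cong) (auto simp: coeff_monom)
    also have "\<dots> = (if I \<subseteq> K \<and> K - I = J then shuffle_sign I J else 0)"
      using K by (simp add: sum.delta)
    also have "\<dots> = coeff (if I \<inter> J = {} then shuffle_sign I J *\<^sub>F monom (I \<union> J) else 0) K"
      using False assms by (auto simp: coeff_monom)
    finally show "coeff (monom I * monom J :: 'k form) K =
      coeff (if I \<inter> J = {} then shuffle_sign I J *\<^sub>F monom (I \<union> J) else 0) K" .
  qed
qed

lemma shuffle_sign_less:
  assumes "\<forall>i\<in>I. \<forall>j\<in>J. i < j"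
  shows "shuffle_sign I J = 1"
proof -
  have *: "{(i, j). i \<in> I \<and> j \<in> J \<and> j < i} = {}" using assms by force
  show ?thesis by (simp only: shuffle_sign_def * card.empty power_0)
qed

lemma shuffle_sign_swap: "j < i \<Longrightarrow> shuffle_sign {i} {j} = -1"
proof -
  assume "j < i"
  then have *: "{(i', j'). i' \<in> {i} \<and> j' \<in> {j} \<and> j' < i'} = {(i, j)}" by auto
  show ?thesis by (simp add: shuffle_sign_def *[simplified])
qed

lemma e_anticommute: "e i * e j = - (e j * e i :: 'k::field form)"
proof (cases i j rule: linorder_cases)
  case less
  then show ?thesis
    by (simp add: monom_mult shuffle_sign_less shuffle_sign_swap insert_commute)
next
  case equal
  then show ?thesis by (simp add: monom_mult)
next
  case greater
  then show ?thesis
    by (simp add: monom_mult shuffle_sign_less shuffle_sign_swap insert_commute)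
qed

lemma e_square [simp]: "e i * e i = (0 :: 'k::field form)"
  by (simp add: monom_mult)

lemma monom_insert_Min:
  assumes "finite I" "\<forall>j\<in>I. i < j"
  shows "monom (insert i I) = (e i * monom I :: 'k::field form)"
  using assms by (subst monom_mult) (auto simp: shuffle_sign_less)

lemma monom_insert_Max:
  assumes "finite I" "\<forall>j\<in>I. j < i"
  shows "monom (insert i I) = (monom I * e i :: 'k::field form)"
  using assms by (subst monom_mult) (auto simp: shuffle_sign_less)

lemma monom_eq_prod_list:
  assumes "sorted_wrt (<) xs"
  shows "monom (set xs) = prod_list (map e xs :: 'k::field form list)"
  using assms
proof (induction xs)
  case (Cons x xs)
  then have "monom (set (x # xs)) = (e x * monom (set xs) :: 'k form)"
    unfolding list.set by (intro monom_insert_Min) auto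
  with Cons show ?case by simp
qed (simp add: monom_empty)

definition lin_ext :: "(nat set \<Rightarrow> 'k::field form) \<Rightarrow> 'k form \<Rightarrow> 'k form" where
  "lin_ext g a = (\<Sum>I | coeff a I \<noteq> 0. coeff a I *\<^sub>F g I)"

lemma lin_ext_superset:
  assumes "finite S" "{I. coeff a I \<noteq> 0} \<subseteq> S"
  shows "lin_ext g a = (\<Sum>I\<in>S. coeff a I *\<^sub>F g I)"
  unfolding lin_ext_def using assms by (intro sum.mono_neutral_left) auto

lemma lin_ext_monom: "finite I \<Longrightarrow> 0 \<notin> I \<Longrightarrow> lin_ext g (monom I) = g I"
  by (subst lin_ext_superset[of "{I}"]) (auto simp: coeff_monom)

lemma lin_ext_expand: "lin_ext g a = (\<Sum>I | coeff a I \<noteq> 0. coeff a I *\<^sub>F lin_ext g (monom I))"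
  unfolding lin_ext_def[of g a]
proof (intro sum.cong refl)
  fix I assume "I \<in> {I. coeff a I \<noteq> 0}"
  then have "finite I" "0 \<notin> I" using coeff_infinite[of I a] by auto
  then show "coeff a I *\<^sub>F g I = coeff a I *\<^sub>F lin_ext g (monom I)" by (simp add: lin_ext_monom)
qed

lemma lin_ext_add: "lin_ext g (a + b) = lin_ext g a + lin_ext g b"
proof -
  let ?S = "{I. coeff a I \<noteq> 0} \<union> {I. coeff b I \<noteq> 0}"
  have "lin_ext g (a + b) = (\<Sum>I\<in>?S. coeff (a + b) I *\<^sub>F g I)"
    by (rule lin_ext_superset) auto
  also have "\<dots> = (\<Sum>I\<in>?S. coeff a I *\<^sub>F g I) + (\<Sum>I\<in>?S. coeff b I *\<^sub>F g I)"
    by (simp only: coeff_add form.scale_left_distrib sum.distrib)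
  also have "\<dots> = lin_ext g a + lin_ext g b"
    by (subst (1 2) lin_ext_superset[of ?S]) auto
  finally show ?thesis .
qed

lemma lin_ext_scale: "lin_ext g (c *\<^sub>F a) = c *\<^sub>F lin_ext g a"
  by (subst (1 2) lin_ext_superset[of "{I. coeff a I \<noteq> 0}"])
    (auto simp: form.scale_sum_right)

lemma lin_ext_linear: "Vector_Spaces.linear scale_form scale_form (lin_ext g)"
  by unfold_locales (simp_all add: lin_ext_add lin_ext_scale)

lemma form_expand: "a = (\<Sum>I | coeff a I \<noteq> 0. coeff a I *\<^sub>F monom I)"
proof (rule form_eqI)
  fix K :: "nat set" assume K: "finite K" "0 \<notin> K"
  have "coeff (\<Sum>I | coeff a I \<noteq> 0. coeff a I *\<^sub>F monom I) K =
    (\<Sum>I | coeff a I \<noteq> 0. if I = K then coeff a K else 0)"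
    unfolding coeff_sum using K by (intro sum.cong) (auto simp: coeff_monom)
  also have "\<dots> = coeff a K" by (simp add: sum.delta)
  finally show "coeff a K = coeff (\<Sum>I | coeff a I \<noteq> 0. coeff a I *\<^sub>F monom I) K" by simp
qed

lemma form_induct [case_names add scale monom]:
  assumes "\<And>a b. P a \<Longrightarrow> P b \<Longrightarrow> P (a + b)" "\<And>c a. P a \<Longrightarrow> P (c *\<^sub>F a)"
    and "\<And>I. finite I \<Longrightarrow> 0 \<notin> I \<Longrightarrow> P (monom I)"
  shows "P (a :: 'k::field form)"
proof -
  have 0: "P 0" using assms(2)[of "monom {}" 0] assms(3)[of "{}"] by simp
  have "P (\<Sum>I\<in>S. coeff a I *\<^sub>F monom I)" if "finite S" "S \<subseteq> {I. coeff a I \<noteq> 0}" for S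
    using that
  proof (induction S)
    case (insert I S)
    then have "finite I \<and> 0 \<notin> I" using coeff_infinite[of I a] by auto
    then show ?case using insert assms by simp
  qed (simp add: 0)
  then show ?thesis by (subst form_expand) simp
qed

text \<open>The derivation with prescribed values \<open>g i\<close> on the generators \<open>e i\<close>; passing a 1-form costs the
  sign \<open>s\<close> (which is \<open>-1\<close> for antiderivations and \<open>1\<close> for derivations of degree 0).\<close>

definition derivation :: "'k::field \<Rightarrow> (nat \<Rightarrow> 'k form) \<Rightarrow> 'k form \<Rightarrow> 'k form" where
  "derivation s g = lin_ext (\<lambda>I. \<Sum>i\<in>I. s ^ card {j\<in>I. j < i} *\<^sub>F
     (monom {j\<in>I. j < i} * g i * monom {j\<in>I. i < j}))"

text \<open>The differential: on 1-forms it is dual to the bracket, i.e. the coefficient of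
  $e^i \wedge e^j$, $i < j$, in $de^k$ is $e^k([e_i, e_j])$. The sum is restricted to $j \<le> k$, as
  $e^k([e_i, e_j]) = 0$ otherwise.\<close>

definition d1 :: "nat \<Rightarrow> 'k::field form" where
  "d1 k = (\<Sum>j\<in>{1..k}. \<Sum>i\<in>{1..<j}. bracket (basis_vec i) (basis_vec j) k *\<^sub>F (e i * e j))"

definition d :: "'k::field form \<Rightarrow> 'k form" where
  "d = derivation (-1) d1"

text \<open>On $e^1$, on which $D_1$ need not be defined, it takes the value 0.\<close>

definition D1 :: "'k::field form \<Rightarrow> 'k form" where
  "D1 = derivation 1 (\<lambda>i. if i \<ge> 3 then e (i - 1) else 0)"

lemma lin_ext_zero [simp]: "lin_ext g 0 = 0"
  by (simp add: lin_ext_def)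

lemma lin_ext_uminus: "lin_ext g (- a) = - lin_ext g a"
  using lin_ext_add[of g a "- a"] by (simp add: eq_neg_iff_add_eq_0 add.commute)

lemmas derivation_add = lin_ext_add[of "\<lambda>I. \<Sum>i\<in>I. s ^ card {j\<in>I. j < i} *\<^sub>F
     (monom {j\<in>I. j < i} * g i * monom {j\<in>I. i < j})" for s g, folded derivation_def]
lemmas derivation_scale = lin_ext_scale[of "\<lambda>I. \<Sum>i\<in>I. s ^ card {j\<in>I. j < i} *\<^sub>F
     (monom {j\<in>I. j < i} * g i * monom {j\<in>I. i < j})" for s g, folded derivation_def]
lemmas derivation_zero [simp] = lin_ext_zero[of "\<lambda>I. \<Sum>i\<in>I. s ^ card {j\<in>I. j < i} *\<^sub>F
     (monom {j\<in>I. j < i} * g i * monom {j\<in>I. i < j})" for s g, folded derivation_def]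
lemmas derivation_uminus = lin_ext_uminus[of "\<lambda>I. \<Sum>i\<in>I. s ^ card {j\<in>I. j < i} *\<^sub>F
     (monom {j\<in>I. j < i} * g i * monom {j\<in>I. i < j})" for s g, folded derivation_def]

lemma derivation_one [simp]: "derivation s g 1 = 0"
  by (simp add: derivation_def monom_empty[symmetric] lin_ext_monom)

lemma derivation_Min_mult:
  fixes g :: "nat \<Rightarrow> 'k::field form"
  assumes I: "finite I" "0 \<notin> I" and i: "i \<noteq> 0" "\<forall>j\<in>I. i < j"
  shows "derivation s g (e i * monom I) = g i * monom I + s *\<^sub>F (e i * derivation s g (monom I))"
proof -
  let ?t = "\<lambda>I i. s ^ card {j\<in>I. j < i} *\<^sub>F (monom {j\<in>I. j < i} * g i * monom {j\<in>I. i < j})"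
  have "e i * monom I = (monom (insert i I) :: 'k form)"
    using I i by (intro monom_insert_Min[symmetric]) auto
  then have "derivation s g (e i * monom I) = (\<Sum>k\<in>insert i I. ?t (insert i I) k)"
    using I i unfolding derivation_def by (simp only:) (rule lin_ext_monom; auto)
  also have "\<dots> = ?t (insert i I) i + (\<Sum>k\<in>I. ?t (insert i I) k)"
    using I i by (intro sum.insert) auto
  also have "?t (insert i I) i = g i * monom I"
  proof -
    have "{j\<in>insert i I. j < i} = {}" "{j\<in>insert i I. i < j} = I" using i by auto
    then show ?thesis by (simp only: card.empty power_0 monom_empty) simp
  qed
  also have "(\<Sum>k\<in>I. ?t (insert i I) k) = (\<Sum>k\<in>I. s *\<^sub>F (e i * ?t I k))"
  proof (rule sum.cong[OF refl])
    fix k assume k: "k \<in> I"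
    have 1: "{j\<in>insert i I. j < k} = insert i {j\<in>I. j < k}" "{j\<in>insert i I. k < j} = {j\<in>I. k < j}"
      using k i by auto
    have 2: "monom (insert i {j\<in>I. j < k}) = (e i * monom {j\<in>I. j < k} :: 'k form)"
      using I i by (intro monom_insert_Min) auto
    have 3: "card (insert i {j\<in>I. j < k}) = Suc (card {j\<in>I. j < k})"
      using I i by (intro card_insert_disjoint) auto
    show "?t (insert i I) k = s *\<^sub>F (e i * ?t I k)"
      unfolding 1 2 3 by (simp add: mult.assoc)
  qed
  also have "\<dots> = s *\<^sub>F (e i * (\<Sum>k\<in>I. ?t I k))"
    by (simp only: sum_distrib_left form.scale_sum_right)
  also have "(\<Sum>k\<in>I. ?t I k) = derivation s g (monom I)"
    using I unfolding derivation_def by (subst lin_ext_monom) simp_all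
  finally show ?thesis .
qed

lemma derivation_e_mult:
  fixes g :: "nat \<Rightarrow> 'k::field form"
  assumes comm: "\<And>i j. g i * e j = - (s *\<^sub>F (e j * g i))" and x: "x \<noteq> 0"
  shows "derivation s g (e x * a) = g x * a + s *\<^sub>F (e x * derivation s g a)"
proof (induction a rule: form_induct)
  case (add a b)
  then show ?case by (simp add: distrib_left derivation_add form.scale_right_distrib)
next
  case (scale c a)
  then show ?case
    by (simp add: derivation_scale form.scale_right_distrib mult.commute)
next
  case (monom I)
  then show ?case
  proof (induction I rule: finite_linorder_min_induct)
    case empty
    then show ?case using derivation_Min_mult[of "{}" x s g] x by (simp add: monom_empty)
  next
    case (insert m I)
    have m: "m \<noteq> 0" and I: "0 \<notin> I" using insert by auto
    have mI: "monom (insert m I) = (e m * monom I :: 'k form)"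
      using insert by (intro monom_insert_Min) auto
    have dm: "derivation s g (e m * monom I) = g m * monom I + s *\<^sub>F (e m * derivation s g (monom I))"
      using insert I m by (intro derivation_Min_mult) auto
    show ?case
    proof (cases x m rule: linorder_cases)
      case less
      with insert x show ?thesis by (intro derivation_Min_mult) auto
    next
      case equal
      have "e x * (e x * c) = 0" for c :: "'k form"
        by (simp add: mult.assoc[symmetric])
      moreover have "g x * (e x * c) = - (s *\<^sub>F (e x * (g x * c)))" for c
        by (simp add: mult.assoc[symmetric] comm)
      ultimately show ?thesis
        unfolding mI using dm equal
        by (simp add: distrib_left form.scale_right_distrib)
    next
      case greater
      obtain c L where cL: "e x * monom I = c *\<^sub>F (monom L :: 'k form)" "finite L" "0 \<notin> L" "\<forall>j\<in>L. m < j"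
      proof (cases "x \<in> I")
        case True
        then have "e x * monom I = 0 *\<^sub>F (monom {} :: 'k form)"
          using insert by (simp add: monom_mult)
        then show ?thesis by (intro that[of 0 "{}"]) auto
      next
        case False
        then have "e x * monom I = shuffle_sign {x} I *\<^sub>F (monom (insert x I) :: 'k form)"
          using insert by (simp add: monom_mult)
        then show ?thesis using insert.hyps I x greater
          by (intro that[of "shuffle_sign {x} I" "insert x I"]) auto
      qed
      have swap: "e x * (e m * b) = - (e m * (e x * b))" for b :: "'k form"
        by (simp only: mult.assoc[symmetric] e_anticommute[of x m] mult_minus_left)
      have gm: "g i * (e j * b) = - (s *\<^sub>F (e j * (g i * b)))" for i j b
        by (simp add: mult.assoc[symmetric] comm)
      have "derivation s g (e x * (e m * monom I)) = - derivation s g (e m * (c *\<^sub>F monom L))"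
        by (simp only: swap derivation_uminus cL)
      also have "\<dots> = - (c *\<^sub>F (g m * monom L + s *\<^sub>F (e m * derivation s g (monom L))))"
        unfolding scale_mult_right derivation_scale
        by (subst derivation_Min_mult) (use cL m in auto)
      also have "\<dots> = - (g m * (c *\<^sub>F monom L) + s *\<^sub>F (e m * derivation s g (c *\<^sub>F monom L)))"
        by (simp add: derivation_scale form.scale_right_distrib mult.commute)
      also have "\<dots> = - (g m * (e x * monom I)) - s *\<^sub>F (e m * derivation s g (e x * monom I))"
        by (simp add: cL)
      also have "derivation s g (e x * monom I) = g x * monom I + s *\<^sub>F (e x * derivation s g (monom I))"
        using insert I by simp
      finally show ?thesis
        unfolding mI dm by (simp add: gm swap distrib_left form.scale_right_distrib algebra_simps)
    qed
  qed
qed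

text \<open>Multiplication by \<open>s ^ q\<close> on forms of degree \<open>q\<close>.\<close>

definition grade_sign :: "'k::field \<Rightarrow> 'k form \<Rightarrow> 'k form" where
  "grade_sign s = lin_ext (\<lambda>I. s ^ card I *\<^sub>F monom I)"

lemma coeff_grade_sign: "coeff (grade_sign s a) I = s ^ card I * coeff a I"
proof (induction a rule: form_induct)
  case (monom J)
  then show ?case by (simp add: grade_sign_def lin_ext_monom coeff_monom)
qed (simp_all add: grade_sign_def lin_ext_add lin_ext_scale algebra_simps)

lemma grade_sign_eqI: "(\<And>I. coeff a I \<noteq> 0 \<Longrightarrow> card I = q) \<Longrightarrow> grade_sign s a = s ^ q *\<^sub>F a"
  by (rule form_eqI) (auto simp: coeff_grade_sign)

lemma grade_sign_mult: "grade_sign s (a * b) = grade_sign s a * grade_sign s b"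
proof (rule form_eqI)
  fix K :: "nat set" assume K: "finite K" "0 \<notin> K"
  have "card K = card I + card (K - I)" if "I \<in> Pow K" for I
    using that K by (metis Pow_iff add.commute card_Diff_subset card_mono diff_add finite_subset)
  then show "coeff (grade_sign s (a * b)) K = coeff (grade_sign s a * grade_sign s b) K"
    unfolding coeff_grade_sign coeff_times sum_distrib_left
    by (intro sum.cong refl) (simp add: power_add mult_ac)
qed

lemma derivation_mult:
  fixes g :: "nat \<Rightarrow> 'k::field form"
  assumes comm: "\<And>i j. g i * e j = - (s *\<^sub>F (e j * g i))"
  shows "derivation s g (a * b) = derivation s g a * b + grade_sign s a * derivation s g b"
proof (induction a rule: form_induct)
  case (add a c)
  then show ?case by (simp add: distrib_right derivation_add grade_sign_def lin_ext_add)
next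
  case (scale c a)
  then show ?case
    by (simp add: derivation_scale form.scale_right_distrib grade_sign_def lin_ext_scale)
next
  case (monom I)
  have gs: "grade_sign s (monom I) = s ^ card I *\<^sub>F monom I" for I
    by (rule grade_sign_eqI) (auto simp: coeff_monom split: if_splits)
  from monom show ?case
  proof (induction I rule: finite_linorder_min_induct)
    case empty
    then show ?case using gs[of "{}"] by (simp add: monom_empty)
  next
    case (insert m I)
    have m: "m \<noteq> 0" "m \<notin> I" and I: "0 \<notin> I" using insert by auto
    have mI: "monom (insert m I) = (e m * monom I :: 'k form)"
      using insert by (intro monom_insert_Min) auto
    have "grade_sign s (e m * monom I) = s *\<^sub>F (e m * grade_sign s (monom I))"
      unfolding gs mI[symmetric] using insert m by (simp add: mI)
    then show ?case
      unfolding mI mult.assoc derivation_e_mult[OF comm m(1)] insert.IH[OF I]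
      by (simp add: distrib_left distrib_right form.scale_right_distrib mult.assoc add.assoc)
  qed
qed

lemma derivation_e: "i \<noteq> 0 \<Longrightarrow> derivation s g (e i) = g i"
  using derivation_Min_mult[of "{}" i s g] by (simp add: monom_empty)

text \<open>$\Lambda^q(e^i : i \in A)$\<close>

definition Lam_on :: "nat set \<Rightarrow> nat \<Rightarrow> 'k::field form set" where
  "Lam_on A q = form.span {monom I | I. finite I \<and> I \<subseteq> A \<and> card I = q}"

text \<open>$\Lambda^q_k$\<close>

definition Lam :: "nat \<Rightarrow> int \<Rightarrow> 'k::field form set" where
  "Lam q k = form.span {monom I | I. finite I \<and> I \<subseteq> {1..} \<and> card I = q \<and> int (\<Sum>I) = k}"

lemma span_monom:
  "form.span {monom I | I. P I} = {a :: 'k::field form. \<forall>I. coeff a I \<noteq> 0 \<longrightarrow> P I}"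
proof (intro equalityI subsetI)
  fix a :: "'k form" assume "a \<in> form.span {monom I | I. P I}"
  moreover have "form.span {monom I | I. P I} \<subseteq> {a :: 'k form. \<forall>I. coeff a I \<noteq> 0 \<longrightarrow> P I}"
  proof (rule form.span_minimal)
    show "form.subspace {a :: 'k form. \<forall>I. coeff a I \<noteq> 0 \<longrightarrow> P I}"
      unfolding form.subspace_def by simp (metis add_0)
  qed (auto simp: coeff_monom split: if_splits)
  ultimately show "a \<in> {a. \<forall>I. coeff a I \<noteq> 0 \<longrightarrow> P I}" by blast
next
  fix a :: "'k form" assume "a \<in> {a. \<forall>I. coeff a I \<noteq> 0 \<longrightarrow> P I}"
  then have "(\<Sum>I | coeff a I \<noteq> 0. coeff a I *\<^sub>F monom I) \<in> form.span {monom I | I. P I}"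
    by (intro form.span_sum form.span_scale form.span_base) auto
  then show "a \<in> form.span {monom I | I. P I}" by (subst form_expand)
qed

lemma in_Lam_on_iff: "a \<in> Lam_on A q \<longleftrightarrow> (\<forall>I. coeff a I \<noteq> 0 \<longrightarrow> I \<subseteq> A \<and> card I = q)"
  unfolding Lam_on_def span_monom using coeff_infinite by blast

lemma in_Lam_iff: "a \<in> Lam q k \<longleftrightarrow> (\<forall>I. coeff a I \<noteq> 0 \<longrightarrow> card I = q \<and> int (\<Sum>I) = k)"
proof -
  have "finite I \<and> I \<subseteq> {1..}" if "coeff a I \<noteq> 0" for I
    using coeff_infinite[of I a] that by (auto simp: Suc_le_eq intro!: gr0I)
  then show ?thesis unfolding Lam_def span_monom by blast
qed

lemma Lam_zero [simp]: "0 \<in> Lam q k"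
  by (simp add: in_Lam_iff)

lemma Lam_add: "a \<in> Lam q k \<Longrightarrow> b \<in> Lam q k \<Longrightarrow> a + b \<in> Lam q k"
  by (simp add: Lam_def form.span_add)

lemma Lam_scale: "a \<in> Lam q k \<Longrightarrow> c *\<^sub>F a \<in> Lam q k"
  by (simp add: Lam_def form.span_scale)

lemma Lam_sum: "(\<And>x. x \<in> A \<Longrightarrow> f x \<in> Lam q k) \<Longrightarrow> sum f A \<in> Lam q k"
  by (simp add: Lam_def form.span_sum)

lemma Lam_uminus: "a \<in> Lam q k \<Longrightarrow> - a \<in> Lam q k"
  by (simp add: Lam_def form.span_neg)

lemma Lam_mult:
  assumes a: "a \<in> Lam q k" and b: "b \<in> Lam p l"
  shows "a * b \<in> Lam (q + p) (k + l)"
  unfolding in_Lam_iff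
proof (intro allI impI)
  fix K assume nz: "coeff (a * b) K \<noteq> 0"
  then have K: "finite K" using coeff_infinite by blast
  have "\<exists>I\<in>Pow K. shuffle_sign I (K - I) * coeff a I * coeff b (K - I) \<noteq> 0"
    using nz unfolding coeff_times by (meson sum.neutral)
  then obtain I where I: "I \<subseteq> K" "coeff a I \<noteq> 0" "coeff b (K - I) \<noteq> 0" by auto
  moreover have "card K = card I + card (K - I)"
    using I K by (metis add.commute card_Diff_subset card_mono diff_add finite_subset)
  moreover have "\<Sum>K = \<Sum>I + \<Sum>(K - I)"
    using I K by (simp add: sum.subset_diff add.commute)
  ultimately show "card K = q + p \<and> int (\<Sum>K) = k + l"
    using a b by (auto simp: in_Lam_iff)
qed

lemma monom_in_Lam: "monom I \<in> Lam (card I) (int (\<Sum>I))"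
  by (auto simp: in_Lam_iff coeff_monom split: if_splits)

lemma e_in_Lam: "e i \<in> Lam 1 (int i)"
  using monom_in_Lam[of "{i}"] by simp

lemma derivation_Lam:
  fixes g :: "nat \<Rightarrow> 'k::field form"
  assumes g: "\<And>i. g i \<in> Lam (1 + r) (int i + w)" and a: "a \<in> Lam q k"
  shows "derivation s g a \<in> Lam (q + r) (k + w)"
proof -
  have *: "derivation s g (monom I) \<in> Lam (card I + r) (int (\<Sum>I) + w)" if "finite I" "0 \<notin> I" for I
    using that
  proof (induction I rule: finite_linorder_min_induct)
    case empty
    then show ?case by (simp add: monom_empty)
  next
    case (insert m I)
    have m: "m \<noteq> 0" "m \<notin> I" and I: "0 \<notin> I" using insert by auto
    have "monom (insert m I) = (e m * monom I :: 'k form)"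
      using insert by (intro monom_insert_Min) auto
    then have eq: "derivation s g (monom (insert m I)) =
        g m * monom I + s *\<^sub>F (e m * derivation s g (monom I))"
      using insert m I by (simp only:) (intro derivation_Min_mult; auto)
    have "g m * monom I \<in> Lam (1 + r + card I) (int m + w + int (\<Sum>I))"
      by (intro Lam_mult g monom_in_Lam)
    moreover have "e m * derivation s g (monom I) \<in> Lam (1 + (card I + r)) (int m + (int (\<Sum>I) + w))"
      using insert I by (intro Lam_mult e_in_Lam) auto
    ultimately show ?case
      unfolding eq using insert m by (intro Lam_add Lam_scale) (simp_all add: algebra_simps)
  qed
  have "derivation s g a = (\<Sum>I | coeff a I \<noteq> 0. coeff a I *\<^sub>F derivation s g (monom I))"
    unfolding derivation_def by (rule lin_ext_expand)
  also have "\<dots> \<in> Lam (q + r) (k + w)"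
  proof (intro Lam_sum Lam_scale)
    fix I assume I: "I \<in> {I. coeff a I \<noteq> 0}"
    then have "finite I" "0 \<notin> I" "card I = q" "int (\<Sum>I) = k"
      using coeff_infinite[of I a] a by (auto simp: in_Lam_iff)
    with * show "derivation s g (monom I) \<in> Lam (q + r) (k + w)" by blast
  qed
  finally show ?thesis .
qed

lemma d1_eq: "d1 k = (if k \<ge> 3 then e 1 * e (k - 1) else (0 :: 'k::field form))"
proof -
  have *: "bracket (basis_vec i) (basis_vec j) k *\<^sub>F (e i * e j :: 'k form) =
      (if i = 1 \<and> j = k - 1 \<and> k \<ge> 3 then e 1 * e (k - 1) else 0)" if "1 \<le> i" "i < j" for i j
    using that by (auto simp: bracket_def basis_vec_def)
  have "(d1 k :: 'k form) =
      (\<Sum>j\<in>{1..k}. \<Sum>i\<in>{1..<j}. if i = 1 \<and> j = k - 1 \<and> k \<ge> 3 then e 1 * e (k - 1) else 0)"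
    unfolding d1_def by (intro sum.cong refl *) auto
  also have "\<dots> = (\<Sum>j\<in>{1..k}. if j = k - 1 \<and> k \<ge> 3 then e 1 * e (k - 1) else 0)"
  proof (intro sum.cong refl)
    fix j
    have "(\<Sum>i\<in>{1..<j}. if i = 1 \<and> j = k - 1 \<and> k \<ge> 3 then e 1 * e (k - 1) else (0 :: 'k form)) =
      (\<Sum>i\<in>{1..<j}. if i = 1 then (if j = k - 1 \<and> k \<ge> 3 then e 1 * e (k - 1) else 0) else 0)"
      by (intro sum.cong) auto
    also have "\<dots> = (if j = k - 1 \<and> k \<ge> 3 then e 1 * e (k - 1) else 0)"
      by (subst sum.delta) auto
    finally show "(\<Sum>i\<in>{1..<j}. if i = 1 \<and> j = k - 1 \<and> k \<ge> 3 then e 1 * e (k - 1) else (0 :: 'k form)) =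
      (if j = k - 1 \<and> k \<ge> 3 then e 1 * e (k - 1) else 0)" .
  qed
  also have "\<dots> = (if k \<ge> 3 then e 1 * e (k - 1) else 0)"
    by (cases "k \<ge> 3") (auto simp: sum.delta)
  finally show ?thesis .
qed

lemma d1_comm: "d1 i * e j = - ((-1) *\<^sub>F (e j * d1 i :: 'k::field form))"
proof -
  have "e 1 * e (i - 1) * e j = - (e 1 * e j * (e (i - 1) :: 'k form))"
    by (simp only: mult.assoc e_anticommute[of "i - 1" j] mult_minus_right)
  also have "\<dots> = e j * (e 1 * e (i - 1))"
    by (simp only: e_anticommute[of 1 j] mult_minus_left minus_minus mult.assoc)
  finally show ?thesis by (simp add: d1_eq del: One_nat_def)
qed

lemma d_one_form: "i \<noteq> 0 \<Longrightarrow> d (e i) = d1 i"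
  by (simp add: d_def derivation_e)

lemma d_e: "d (e 1) = 0" "d (e 2) = 0" "i \<ge> 3 \<Longrightarrow> d (e i) = e 1 * e (i - 1)"
  by (simp_all add: d_one_form d1_eq)

lemma d_add: "d (a + b) = d a + d b"
  by (simp add: d_def derivation_add)
lemma d_scale: "d (c *\<^sub>F a) = c *\<^sub>F d a"
  by (simp add: d_def derivation_scale)
lemma d_zero [simp]: "d 0 = 0"
  by (simp add: d_def)
lemma d_uminus: "d (- a) = - d a"
  by (simp add: d_def derivation_uminus)
lemma d_minus: "d (a - b) = d a - d b"
  using d_add[of a "- b"] by (simp add: d_uminus)
lemma d_one [simp]: "d 1 = 0"
  by (simp add: d_def)

lemma d_e_mult: "i \<noteq> 0 \<Longrightarrow> d (e i * a) = d1 i * a - e i * d a"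
  unfolding d_def by (simp add: derivation_e_mult[OF d1_comm])

lemma d_mult: "d (a * b) = d a * b + grade_sign (-1) a * d b"
  unfolding d_def by (rule derivation_mult) (rule d1_comm)

lemma d_leibniz:
  assumes "a \<in> Lam_on A q"
  shows "d (a * b) = d a * b + (-1) ^ q * (a * d b)"
proof -
  have "grade_sign (-1) a = (-1) ^ q *\<^sub>F a"
    using assms by (intro grade_sign_eqI) (auto simp: in_Lam_on_iff)
  then show ?thesis by (cases "even q") (simp_all add: d_mult)
qed

lemma d_Lam: "a \<in> Lam q k \<Longrightarrow> d a \<in> Lam (q + 1) k"
proof -
  assume a: "a \<in> Lam q k"
  have "d1 i \<in> Lam (1 + 1) (int i + 0)" for i
    using Lam_mult[OF e_in_Lam[of 1] e_in_Lam[of "i - 1"]] by (auto simp: d1_eq)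
  from derivation_Lam[OF this a, of "-1"] show ?thesis by (simp add: d_def)
qed

lemma d_d: "d (d a) = (0 :: 'k::field form)"
proof (induction a rule: form_induct)
  case (monom I)
  then show ?case
  proof (induction I rule: finite_linorder_min_induct)
    case empty
    then show ?case by (simp add: monom_empty)
  next
    case (insert m I)
    have m: "m \<noteq> 0" and I: "0 \<notin> I" using insert by auto
    have mI: "monom (insert m I) = (e m * monom I :: 'k form)"
      using insert by (intro monom_insert_Min) auto
    have 1: "d (e m * a) = d1 m * a - e m * d a" for a :: "'k form"
      using m by (rule d_e_mult)
    have 2: "d (d1 m * a) = d1 m * d a" for a :: "'k form"
    proof -
      have "d (e 1 * (e i * a)) = e 1 * (e i * d a)" if "i \<ge> 2" for i and a :: "'k form"
      proof -
        have "e 1 * (d1 i * a) = 0"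
          by (simp add: d1_eq mult.assoc[symmetric])
        moreover have "d (e i * a) = d1 i * a - e i * d a"
          using that by (intro d_e_mult) auto
        moreover have "d (e 1 * b) = - (e 1 * d b)" for b :: "'k form"
          using d_e_mult[of 1 b] by (simp add: d1_eq)
        ultimately show ?thesis by (simp add: right_diff_distrib)
      qed
      then show ?thesis by (simp add: d1_eq mult.assoc)
    qed
    show ?case unfolding mI 1 d_minus 2 using insert I by simp
  qed
qed (simp_all add: d_add d_scale)

lemma d_grade_sign: "d (grade_sign (-1) a) = - grade_sign (-1) (d a :: 'k::field form)"
proof (induction a rule: form_induct)
  case (monom I)
  have "grade_sign (-1) (monom I :: 'k form) = (-1) ^ card I *\<^sub>F monom I"
    by (rule grade_sign_eqI) (auto simp: coeff_monom split: if_splits)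
  moreover have "grade_sign (-1) (d (monom I) :: 'k form) = (-1) ^ (card I + 1) *\<^sub>F d (monom I)"
    using d_Lam[OF monom_in_Lam[of I]] by (intro grade_sign_eqI) (auto simp: in_Lam_iff)
  ultimately show ?case by (simp add: d_scale)
qed (simp_all add: grade_sign_def d_add d_scale lin_ext_add lin_ext_scale)

lemma coeff_d_empty: "coeff (d a) {} = 0"
proof (induction a rule: form_induct)
  case (monom I)
  then show ?case using d_Lam[OF monom_in_Lam[of I]] by (auto simp: in_Lam_iff)
qed (simp_all add: d_add d_scale)

lemma D1_e: "D1 (e 1) = 0" "D1 (e 2) = 0" "i \<ge> 3 \<Longrightarrow> D1 (e i) = e (i - 1)"
  by (simp_all add: D1_def derivation_e)

lemma D1_add: "D1 (a + b) = D1 a + D1 b"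
  by (simp add: D1_def derivation_add)
lemma D1_scale: "D1 (c *\<^sub>F a) = c *\<^sub>F D1 a"
  by (simp add: D1_def derivation_scale)

lemma D1_mult: "D1 (a * b) = D1 a * b + a * D1 (b :: 'k::field form)"
proof -
  have "grade_sign 1 a = a" by (rule form_eqI) (simp add: coeff_grade_sign)
  moreover have "(if i \<ge> 3 then e (i - 1) else 0) * e j =
      - (1 *\<^sub>F (e j * (if i \<ge> 3 then e (i - 1) else 0 :: 'k form)))" for i j
    using e_anticommute[of "i - 1" j, where 'k = 'k] by simp
  ultimately show ?thesis unfolding D1_def by (subst derivation_mult) simp_all
qed

lemma D1_Lam: "a \<in> Lam q k \<Longrightarrow> D1 a \<in> Lam q (k - 1)"
proof -
  assume a: "a \<in> Lam q k"
  have "(if i \<ge> 3 then e (i - 1) else 0) \<in> Lam (1 + 0) (int i + (- 1))" for i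
    using e_in_Lam[of "i - 1"] by (auto simp: of_nat_diff)
  from derivation_Lam[OF this a, of 1] show ?thesis by (simp add: D1_def)
qed

lemma D1_pow_Lam: "a \<in> Lam q k \<Longrightarrow> (D1 ^^ n) a \<in> Lam q (k - int n)"
proof (induction n)
  case (Suc n)
  then have "D1 ((D1 ^^ n) a) \<in> Lam q (k - int n - 1)" by (intro D1_Lam) simp
  moreover have "k - int n - 1 = k - int (Suc n)" by simp
  ultimately show ?case by simp
qed simp

text \<open>Hence all sums over powers of $D_1$ below are finite.\<close>

lemma D1_nilpotent: "finite {n. (D1 ^^ n) (a :: 'k::field form) \<noteq> 0}"
proof -
  have pow_add: "(D1 ^^ n) (a + b) = (D1 ^^ n) a + (D1 ^^ n) b" for n and a b :: "'k form"
    by (induction n) (simp_all add: D1_add)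
  have pow_scale: "(D1 ^^ n) (c *\<^sub>F a) = c *\<^sub>F (D1 ^^ n) a" for n c and a :: "'k form"
    by (induction n) (simp_all add: D1_scale)
  show ?thesis
  proof (induction a rule: form_induct)
    case (add a b)
    have "{n. (D1 ^^ n) (a + b) \<noteq> 0} \<subseteq> {n. (D1 ^^ n) a \<noteq> 0} \<union> {n. (D1 ^^ n) b \<noteq> 0}"
      by (auto simp: pow_add)
    with add show ?case by (meson finite_Un finite_subset)
  next
    case (scale c a)
    have "{n. (D1 ^^ n) (c *\<^sub>F a) \<noteq> 0} \<subseteq> {n. (D1 ^^ n) a \<noteq> 0}"
      by (auto simp: pow_scale)
    with scale show ?case by (meson finite_subset)
  next
    case (monom I)
    have "(D1 ^^ n) (monom I) = (0 :: 'k form)" if "n > \<Sum>I" for n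
    proof (rule form_eqI)
      fix J
      show "coeff ((D1 ^^ n) (monom I :: 'k form)) J = coeff 0 J"
        using D1_pow_Lam[OF monom_in_Lam[of I], of n] that unfolding in_Lam_iff coeff_zero
        by (smt (verit) of_nat_0_le_iff of_nat_less_iff)
    qed
    then have "{n. (D1 ^^ n) (monom I) \<noteq> (0 :: 'k form)} \<subseteq> {..\<Sum>I}"
      by (metis (mono_tags, lifting) atMost_iff linorder_not_le mem_Collect_eq subsetI)
    then show ?case by (rule finite_subset) simp
  qed
qed

definition cohomologous :: "'k::field form \<Rightarrow> 'k form \<Rightarrow> bool" where
  "cohomologous a b \<longleftrightarrow> d a = 0 \<and> d b = 0 \<and> a - b \<in> range d"

lemma cohomologousI: "d a = 0 \<Longrightarrow> d b = 0 \<Longrightarrow> a - b = d c \<Longrightarrow> cohomologous a b"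
  by (auto simp: cohomologous_def)

lemma part_equivp_cohomologous: "part_equivp (cohomologous :: 'k::field form \<Rightarrow> _)"
proof (rule part_equivpI)
  show "\<exists>a. cohomologous a (a :: 'k form)"
    by (intro exI[of _ 0]) (auto simp: cohomologous_def intro: rev_image_eqI[of 0])
  show "symp (cohomologous :: 'k form \<Rightarrow> _)"
  proof (rule sympI)
    fix a b :: "'k form" assume "cohomologous a b"
    then obtain c where c: "d a = 0" "d b = 0" "a - b = d c" by (auto simp: cohomologous_def)
    then have "b - a = d (- c)" by (simp add: d_uminus flip: c(3))
    with c show "cohomologous b a" by (intro cohomologousI)
  qed
  show "transp (cohomologous :: 'k form \<Rightarrow> _)"
  proof (rule transpI)
    fix a b c :: "'k form" assume "cohomologous a b" "cohomologous b c"
    then obtain x y where xy: "d a = 0" "d b = 0" "d c = 0" "a - b = d x" "b - c = d y"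
      by (auto simp: cohomologous_def)
    have "a - c = (a - b) + (b - c)" by simp
    also have "\<dots> = d (x + y)" by (simp only: xy d_add)
    finally show "cohomologous a c" using xy by (intro cohomologousI)
  qed
qed

lemma cohomologous_refl_iff: "cohomologous a a \<longleftrightarrow> d a = 0"
  by (auto simp: cohomologous_def intro: rev_image_eqI[of 0])

text \<open>The total cohomology $H^*(\mathfrak m_0)$ of finite forms: cocycles modulo coboundaries.
  Formal series would only replace the direct sum over the second grading by a product.\<close>

quotient_type (overloaded) 'k coh = "'k::field form" / partial: cohomologous
  by (rule part_equivp_cohomologous)

text \<open>The class of a cocycle (no meaning is attached to the value on other forms).\<close>

abbreviation cls :: "'k::field form \<Rightarrow> 'k coh" where "cls \<equiv> abs_coh"

lemma cls_eq_iff: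
  assumes "d a = 0" "d b = 0"
  shows "cls a = cls b \<longleftrightarrow> a - b \<in> range d"
  using Quotient3_rel[OF Quotient3_coh, of a b] assms
  by (simp add: cohomologous_refl_iff) (simp add: cohomologous_def)

lemma cls_exhaust:
  obtains a where "d a = 0" "x = cls a"
  using Quotient3_rep_reflp[OF Quotient3_coh, of x] Quotient3_abs_rep[OF Quotient3_coh, of x]
  by (metis cohomologous_refl_iff)

lift_definition scale_coh :: "'k::field \<Rightarrow> 'k coh \<Rightarrow> 'k coh"  (infixr \<open>*\<^sub>H\<close> 75) is scale_form
proof -
  fix c :: 'k and a b :: "'k form" assume "cohomologous a b"
  then obtain x where x: "d a = 0" "d b = 0" "a - b = d x" by (auto simp: cohomologous_def)
  then have "c *\<^sub>F a - c *\<^sub>F b = d (c *\<^sub>F x)"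
    by (simp add: d_scale form.scale_right_diff_distrib flip: x(3))
  then show "cohomologous (c *\<^sub>F a) (c *\<^sub>F b)"
    by (rule cohomologousI[rotated 2]) (simp_all add: d_scale x)
qed

instantiation coh :: (field) ring_1
begin

lift_definition zero_coh :: "'a coh" is 0 by (simp add: cohomologous_refl_iff)

lift_definition one_coh :: "'a coh" is 1 by (simp add: cohomologous_refl_iff)

lift_definition plus_coh :: "'a coh \<Rightarrow> 'a coh \<Rightarrow> 'a coh" is plus
proof -
  fix a a' b b' :: "'a form" assume "cohomologous a a'" "cohomologous b b'"
  then obtain x y where xy: "d a = 0" "d a' = 0" "d b = 0" "d b' = 0" "a - a' = d x" "b - b' = d y"
    by (auto simp: cohomologous_def)
  have "(a + b) - (a' + b') = (a - a') + (b - b')" by simp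
  also have "\<dots> = d (x + y)" by (simp only: xy d_add)
  finally show "cohomologous (a + b) (a' + b')"
    by (rule cohomologousI[rotated 2]) (simp_all add: d_add xy)
qed

lift_definition uminus_coh :: "'a coh \<Rightarrow> 'a coh" is uminus
proof -
  fix a b :: "'a form" assume "cohomologous a b"
  then obtain x where x: "d a = 0" "d b = 0" "a - b = d x" by (auto simp: cohomologous_def)
  have "- a - - b = d (- x)" by (simp add: d_uminus flip: x(3))
  then show "cohomologous (- a) (- b)"
    by (rule cohomologousI[rotated 2]) (simp_all add: d_uminus x)
qed

definition minus_coh :: "'a coh \<Rightarrow> 'a coh \<Rightarrow> 'a coh" where "minus_coh x y = x + - y"

lift_definition times_coh :: "'a coh \<Rightarrow> 'a coh \<Rightarrow> 'a coh" is times
proof -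
  fix a a' b b' :: "'a form" assume "cohomologous a a'" "cohomologous b b'"
  then obtain x y where xy: "d a = 0" "d a' = 0" "d b = 0" "d b' = 0" "a - a' = d x" "b - b' = d y"
    by (auto simp: cohomologous_def)
  have 1: "d (x * b) = (a - a') * b" by (simp add: d_mult xy)
  have gs: "grade_sign (-1) (grade_sign (-1) a') = a'"
    by (rule form_eqI) (simp add: coeff_grade_sign mult.assoc[symmetric] power_mult_distrib[symmetric])
  have 2: "d (grade_sign (-1) a' * y) = a' * (b - b')"
    by (simp add: d_mult d_grade_sign xy gs) (simp add: grade_sign_def)
  have "a * b - a' * b' = (a - a') * b + a' * (b - b')" by (simp add: algebra_simps)
  also have "\<dots> = d (x * b + grade_sign (-1) a' * y)" by (simp only: d_add 1 2)
  finally show "cohomologous (a * b) (a' * b')"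
    by (rule cohomologousI[rotated 2]) (simp_all add: d_mult xy)
qed

lemma cls_simps:
  assumes "d a = 0" "d b = 0"
  shows "cls a + cls b = cls (a + b)" "- cls a = cls (- a)" "cls a * cls b = cls (a * b)"
    "c *\<^sub>H cls a = cls (c *\<^sub>F a)"
  using assms
  by (simp_all add: plus_coh.abs_eq uminus_coh.abs_eq times_coh.abs_eq scale_coh.abs_eq
      cohomologous_refl_iff)

lemmas cls_01 = zero_coh.abs_eq one_coh.abs_eq

instance
proof
  fix x y z :: "'a coh"
  obtain a b c where abc: "d a = 0" "d b = 0" "d c = 0" "x = cls a" "y = cls b" "z = cls c"
    by (metis cls_exhaust)
  note [simp] = cls_simps cls_01 d_add d_mult d_uminus
  show "x * y * z = x * (y * z)" "x + y + z = x + (y + z)" "x + y = y + x"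
    "0 + x = x" "- x + x = 0" "1 * x = x" "x * 1 = x"
    "(x + y) * z = x * z + y * z" "x * (y + z) = x * y + x * z"
    using abc by (simp_all add: algebra_simps)
  show "x - y = x + - y" by (simp add: minus_coh_def)
  have "coeff (0 - 1 :: 'a form) {} \<noteq> 0" by (simp add: one_form_def coeff_monom)
  then have "(0 - 1 :: 'a form) \<notin> range d" by (metis coeff_d_empty rangeE)
  then show "0 \<noteq> (1 :: 'a coh)" by (simp add: cls_eq_iff)
qed

end

global_interpretation coh: vector_space "scale_coh :: 'k::field \<Rightarrow> 'k coh \<Rightarrow> 'k coh"
proof
  fix c c' :: 'k and x y :: "'k coh"
  obtain a b where ab: "d a = 0" "d b = 0" "x = cls a" "y = cls b"
    by (metis cls_exhaust)
  note [simp] = cls_simps d_add d_scale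
  show "c *\<^sub>H (x + y) = c *\<^sub>H x + c *\<^sub>H y" "(c + c') *\<^sub>H x = c *\<^sub>H x + c' *\<^sub>H x"
    "c *\<^sub>H c' *\<^sub>H x = (c * c') *\<^sub>H x" "1 *\<^sub>H x = x"
    using ab by (simp_all add: form.scale_right_distrib form.scale_left_distrib)
qed

definition proj :: "nat \<Rightarrow> int \<Rightarrow> 'k::field form \<Rightarrow> 'k form" where
  "proj q k = lin_ext (\<lambda>I. if card I = q \<and> int (\<Sum>I) = k then monom I else 0)"

lemma coeff_proj: "coeff (proj q k a) I = (if card I = q \<and> int (\<Sum>I) = k then coeff a I else 0)"
  unfolding proj_def
proof (induction a rule: form_induct)
  case (monom J)
  then show ?case by (simp add: lin_ext_monom coeff_monom del: of_nat_sum)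
qed (simp_all add: lin_ext_add lin_ext_scale del: of_nat_sum)

lemma proj_in_Lam: "proj q k a \<in> Lam q k"
  by (auto simp: in_Lam_iff coeff_proj simp del: of_nat_sum split: if_splits)

lemma proj_id: "a \<in> Lam q k \<Longrightarrow> proj q k a = a"
  by (intro form_eqI) (auto simp: in_Lam_iff coeff_proj simp del: of_nat_sum)

lemma proj_other: "a \<in> Lam q k \<Longrightarrow> (q, k) \<noteq> (q', k') \<Longrightarrow> proj q' k' a = 0"
  by (intro form_eqI) (auto simp: in_Lam_iff coeff_proj simp del: of_nat_sum)

lemma d_proj: "d (proj q k a) = proj (Suc q) k (d (a :: 'k::field form))"
proof (induction a rule: form_induct)
  case (monom I)
  have dI: "d (monom I) \<in> (Lam (Suc (card I)) (int (\<Sum>I)) :: 'k form set)"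
    using d_Lam[OF monom_in_Lam[of I]] by simp
  show ?case
  proof (cases "card I = q \<and> int (\<Sum>I) = k")
    case True
    then have "proj q k (monom I) = (monom I :: 'k form)"
      "proj (Suc q) k (d (monom I)) = (d (monom I) :: 'k form)"
      using proj_id[OF monom_in_Lam[of I]] proj_id[OF dI] by blast+
    then show ?thesis by simp
  next
    case False
    then have "proj q k (monom I) = (0 :: 'k form)"
      by (intro proj_other[OF monom_in_Lam[of I]]) auto
    moreover have "proj (Suc q) k (d (monom I)) = (0 :: 'k form)"
      using False by (intro proj_other[OF dI]) auto
    ultimately show ?thesis by simp
  qed
qed (simp_all add: proj_def d_add d_scale lin_ext_add lin_ext_scale)

lemma proj_d_0: "proj 0 k (d c) = 0"
proof (rule form_eqI)
  fix I :: "nat set" assume "finite I"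
  then show "coeff (proj 0 k (d c)) I = coeff 0 I" by (auto simp: coeff_proj coeff_d_empty)
qed

text \<open>$H^q_k(\mathfrak m_0)$, as a subspace of the total cohomology; by \<open>cls_eq_iff_bigraded\<close> it is the
  degree \<open>q\<close> cohomology of the complex $(\Lambda^*_k, d)$.\<close>

definition H :: "nat \<Rightarrow> int \<Rightarrow> 'k::field coh set" where
  "H q k = cls ` {a \<in> Lam q k. d a = 0}"

lemma cls_eq_iff_bigraded:
  fixes a b :: "'k::field form"
  assumes ab: "a \<in> Lam q k" "d a = 0" "b \<in> Lam q k" "d b = 0"
  shows "cls a = cls b \<longleftrightarrow> (if q = 0 then a = b else a - b \<in> d ` Lam (q - 1) k)"
proof -
  have ab': "a - b \<in> Lam q k"
    using Lam_add[OF ab(1) Lam_uminus[OF ab(3)]] by simp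
  have iff: "cls a = cls b \<longleftrightarrow> a - b \<in> range d" using ab by (simp add: cls_eq_iff)
  show ?thesis
  proof (cases q)
    case 0
    have "a = b" if "a - b = d c" for c
      using proj_d_0[of k c] proj_id[OF ab'] that 0 by simp
    then show ?thesis using 0 iff by auto
  next
    case (Suc p)
    have "a - b \<in> d ` Lam p k" if "a - b = d c" for c
    proof -
      have "a - b = d (proj p k c)" using proj_id[OF ab'] that Suc by (simp add: d_proj)
      with proj_in_Lam show ?thesis by blast
    qed
    then show ?thesis using Suc iff by auto
  qed
qed

lemma H_subspace: "coh.subspace (H q k)"
  unfolding coh.subspace_def
proof (intro conjI ballI allI)
  show "0 \<in> H q k" unfolding H_def by (rule rev_image_eqI[of 0]) (simp_all add: cls_01)
next
  fix x y :: "'a coh" assume "x \<in> H q k" "y \<in> H q k"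
  then obtain a b where "a \<in> Lam q k" "d a = 0" "x = cls a" "b \<in> Lam q k" "d b = 0" "y = cls b"
    by (auto simp: H_def)
  then show "x + y \<in> H q k"
    unfolding H_def by (intro rev_image_eqI[of "a + b"]) (auto simp: cls_simps Lam_add d_add)
next
  fix c and x :: "'a coh" assume "x \<in> H q k"
  then obtain a where "a \<in> Lam q k" "d a = 0" "x = cls a"
    by (auto simp: H_def)
  then show "c *\<^sub>H x \<in> H q k"
    unfolding H_def by (intro rev_image_eqI[of "c *\<^sub>F a"]) (auto simp: cls_simps Lam_scale d_scale)
qed

lemma H_finite_dim: "\<exists>B. finite B \<and> H q k \<subseteq> coh.span (B :: 'k::field coh set)"
proof -
  let ?S = "{monom I :: 'k form | I. finite I \<and> I \<subseteq> {1..} \<and> card I = q \<and> int (\<Sum>I) = k}"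
  let ?Z = "{a \<in> Lam q k. d a = (0 :: 'k form)}"
  have "?S \<subseteq> monom ` Pow {..nat k}"
  proof
    fix a assume "a \<in> ?S"
    then obtain I where I: "a = monom I" "finite I" "int (\<Sum>I) = k" by blast
    have "i \<le> nat k" if "i \<in> I" for i
      using member_le_sum[of i I id] that I by (simp add: nat_int flip: I(3) of_nat_sum)
    with I show "a \<in> monom ` Pow {..nat k}" by blast
  qed
  then have S: "finite ?S" by (rule finite_subset) simp
  obtain B where B: "B \<subseteq> ?Z" "form.independent B" "?Z \<subseteq> form.span B"
    by (rule form.basis_exists[of ?Z])
  have "B \<subseteq> form.span ?S" unfolding Lam_def[symmetric] using B(1) by blast
  then have fin: "finite B" by (rule form.independent_span_bound[OF S B(2), THEN conjunct1])
  have "d a = 0 \<and> cls a \<in> coh.span (cls ` B)" if "a \<in> form.span B" for a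
    using that
  proof (induction rule: form.span_induct_alt)
    case base
    show ?case using coh.span_zero[of "cls ` B"] by (simp add: cls_01)
  next
    case (step c x y)
    then have x: "d x = 0" "cls x \<in> coh.span (cls ` B)"
      using B(1) by (auto intro: coh.span_base)
    then have "c *\<^sub>H cls x + cls y \<in> coh.span (cls ` B)"
      using step by (intro coh.span_add coh.span_scale) auto
    with x step show ?case by (simp add: cls_simps d_add d_scale)
  qed
  with B(3) have "H q k \<subseteq> coh.span (cls ` B)" by (auto simp: H_def)
  with fin show ?thesis by blast
qed

lemma cls_sum:
  "(\<And>x. x \<in> A \<Longrightarrow> d (f x) = 0) \<Longrightarrow> d (sum f A) = 0 \<and> cls (sum f A) = (\<Sum>x\<in>A. cls (f x))"
proof (induction A rule: infinite_finite_induct)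
  case (insert x F)
  then show ?case using cls_simps(1)[of "f x" "sum f F"] by (simp add: d_add)
qed (simp_all add: cls_01)

text \<open>$H^*(\mathfrak m_0)$ is the direct sum of the spaces $H^q_k(\mathfrak m_0)$.\<close>

lemma span_H: "coh.span (\<Union>q k. H q k) = (UNIV :: 'k::field coh set)"
proof (intro equalityI subsetI)
  fix x :: "'k coh"
  obtain a where a: "d a = 0" "x = cls a" by (rule cls_exhaust)
  define S where "S = (\<lambda>I. (card I, int (\<Sum>I))) ` {I. coeff a I \<noteq> 0}"
  have S: "finite S" by (simp add: S_def)
  have "a = (\<Sum>(q, k)\<in>S. proj q k a)"
  proof (rule form_eqI)
    fix I
    have "coeff (\<Sum>(q, k)\<in>S. proj q k a) I =
        (\<Sum>p\<in>S. if p = (card I, int (\<Sum>I)) then coeff a I else 0)"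
      unfolding coeff_sum
      by (intro sum.cong) (auto simp: coeff_proj simp del: of_nat_sum split: if_splits)
    also have "\<dots> = coeff a I"
      using S by (auto simp: sum.delta S_def simp del: of_nat_sum)
    finally show "coeff a I = coeff (\<Sum>(q, k)\<in>S. proj q k a) I" by simp
  qed
  moreover have dp: "d (proj q k a) = 0" for q k
    using a(1) by (simp add: d_proj) (simp add: proj_def)
  ultimately have "x = (\<Sum>p\<in>S. cls (case p of (q, k) \<Rightarrow> proj q k a))"
    using cls_sum[of S "\<lambda>(q, k). proj q k a"] a(2) by (simp add: split_beta)
  also have "\<dots> \<in> coh.span (\<Union>q k. H q k)"
  proof (rule coh.span_sum)
    fix p assume "p \<in> S"
    have "cls (case p of (q, k) \<Rightarrow> proj q k a) \<in> H (fst p) (snd p)"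
      unfolding H_def split_beta by (intro imageI CollectI conjI proj_in_Lam dp)
    then show "cls (case p of (q, k) \<Rightarrow> proj q k a) \<in> coh.span (\<Union>q k. H q k)"
      by (intro coh.span_base) blast
  qed
  finally show "x \<in> coh.span (\<Union>q k. H q k)" .
qed simp

lemma H_direct:
  fixes x :: "nat \<times> int \<Rightarrow> 'k::field coh"
  assumes S: "finite S" and x: "\<And>q k. (q, k) \<in> S \<Longrightarrow> x (q, k) \<in> H q k"
    and sum: "(\<Sum>p\<in>S. x p) = 0" and qk: "(q, k) \<in> S"
  shows "x (q, k) = 0"
proof -
  have "\<forall>p\<in>S. \<exists>a. a \<in> Lam (fst p) (snd p) \<and> d a = 0 \<and> x p = cls a"
    using x by (fastforce simp: H_def)
  then obtain a where a: "a p \<in> Lam (fst p) (snd p)" "d (a p) = 0" "x p = cls (a p)" if "p \<in> S" for p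
    by metis
  have "d (\<Sum>p\<in>S. a p) = 0" "cls (\<Sum>p\<in>S. a p) = cls 0"
    using cls_sum[of S a] a sum by (simp_all add: cls_01)
  then obtain c where c: "(\<Sum>p\<in>S. a p) = d c" by (auto simp: cls_eq_iff)
  have "proj q k (\<Sum>p\<in>S. a p) = (\<Sum>p\<in>S. proj q k (a p))"
    unfolding proj_def using S by (induction S) (simp_all add: lin_ext_add)
  also have "\<dots> = (\<Sum>p\<in>S. if p = (q, k) then a (q, k) else 0)"
  proof (intro sum.cong refl)
    fix p assume p: "p \<in> S"
    show "proj q k (a p) = (if p = (q, k) then a (q, k) else 0)"
    proof (cases "p = (q, k)")
      case True
      then show ?thesis using proj_id[OF a(1)[OF p]] by simp
    next
      case False
      then show ?thesis using proj_other[OF a(1)[OF p], of q k] by simp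
    qed
  qed
  also have "\<dots> = a (q, k)" using S qk by (simp add: sum.delta)
  finally have "a (q, k) = proj q k (d c)" by (simp add: c)
  also have "\<dots> \<in> range d"
  proof (cases q)
    case 0
    then show ?thesis using proj_d_0[of k c] by (auto intro: range_eqI[of _ _ 0])
  next
    case (Suc p)
    then show ?thesis by (simp flip: d_proj)
  qed
  finally have "cls (a (q, k)) = cls 0" using a(2)[OF qk] by (simp add: cls_eq_iff)
  then show ?thesis using a(3)[OF qk] by (simp add: cls_01)
qed

lemma H_mult: "x \<in> H q k \<Longrightarrow> y \<in> H p l \<Longrightarrow> x * y \<in> H (q + p) (k + l)"
  unfolding H_def by (auto simp: cls_simps d_mult intro!: imageI Lam_mult)

text \<open>On the monomial with superscripts \<open>K\<close>, whose two largest elements are \<open>m - 1\<close> and \<open>m\<close>,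
  \<open>omega\<close> is given by the sum defining $\omega$. Off the domain of $\omega$ its values are irrelevant:
  the formula is kept if \<open>1 \<in> K\<close>, and the value is 0 if the two largest superscripts are not
  consecutive. \<open>Sum_any\<close> is the sum of the finitely many nonzero terms.\<close>

definition omega :: "'k::field form \<Rightarrow> 'k form" where
  "omega = lin_ext (\<lambda>K. let m = Max K; I = K - {m} in
     if I \<noteq> {} \<and> m = Max I + 1
     then Sum_any (\<lambda>l. (-1) ^ l * (D1 ^^ l) (monom I) * e (m + l)) else 0)"

lemma omega_add: "omega (a + b) = omega a + omega b"
  by (simp add: omega_def lin_ext_add)

lemma omega_scale: "omega (c *\<^sub>F a) = c *\<^sub>F omega a"
  by (simp add: omega_def lin_ext_scale)

lemma omega_monom:
  assumes "finite I" "I \<noteq> {}" "0 \<notin> I"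
  shows "omega (monom I * e (Max I + 1) :: 'k::field form) =
    Sum_any (\<lambda>l. (-1) ^ l * (D1 ^^ l) (monom I) * e (Max I + 1 + l))"
proof -
  let ?m = "Max I + 1" and ?K = "insert (Max I + 1) I"
  have lt: "\<forall>j\<in>I. j < ?m" using assms by (simp add: less_Suc_eq_le)
  have "?m \<notin> I" using lt by blast
  then have 1: "?K - {?m} = I" by simp
  have 2: "Max ?K = ?m"
    using assms by (subst Max_insert) (simp_all add: max_def)
  have 3: "monom I * e ?m = (monom ?K :: 'k form)"
    by (rule monom_insert_Max[OF assms(1) lt, symmetric])
  have "omega (monom ?K :: 'k form) = (let m = Max ?K; J = ?K - {m} in
     if J \<noteq> {} \<and> m = Max J + 1
     then Sum_any (\<lambda>l. (-1) ^ l * (D1 ^^ l) (monom J) * e (m + l)) else 0)"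
    unfolding omega_def by (rule lin_ext_monom) (use assms in auto)
  then show ?thesis
    unfolding 3 Let_def 2 1 using assms(2) by simp
qed

definition num_partitions :: "nat \<Rightarrow> int \<Rightarrow> nat" where
  "num_partitions q N = card {xs :: nat list. length xs = q \<and> sorted xs \<and> (\<forall>x\<in>set xs. 1 \<le> x) \<and> int (sum_list xs) = N}"

end

theory Submission
  imports Defs
begin

text \<open>Every form $a$ satisfies $da = e^1 \wedge D_1 a$. The operator
  $D_{-1}(\xi \wedge e^m) = \sum_{l \ge 0} (-1)^l D_1^l \xi \wedge e^{m+1+l}$ is a right inverse of $D_1$ on
  forms of positive degree in $e^2, e^3, \dots$, so the cohomology in positive degree is
  $\ker D_1 \oplus \langle e^1 \rangle$. If $\omega$ is extended by 0 to the monomials whose two largest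
  superscripts are not consecutive, then $a = \omega(a) + D_{-1} D_1 a$ in degrees at least 2, so
  $\omega$ fixes $\ker D_1$. The product formula results from applying $\omega$ to the double sum
  $\omega(\xi \wedge e^i \wedge e^{i+1}) \wedge \omega(\eta \wedge e^j \wedge e^{j+1})$, where it kills all but
  the terms with consecutive largest superscripts. As $D_{-1}$ only yields monomials of the other
  kind, $\omega$ is injective on the monomials with consecutive largest superscripts; these are
  counted by lowering the largest superscript of the others.\<close>

section \<open>Alternating sums of powers of $D_1$\<close>

text \<open>Write S(a, m) for \<open>D1_series a m\<close>, the alternating sum of the terms
  \<open>(D1 ^^ l) a * e (m + l)\<close>. It yields both operators: omega(a * e^m) is S(a, m) when
  e^(m-1) is the last factor of a, and D_{-1}(a * e^(m-1)) is S(a, m) when all superscripts of a are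
  below m-1. For m at least 3, applying D_1 telescopes S(a, m) to a * e^(m-1), which is 0 in the
  first case and the required preimage in the second. The recursion S(a, m) = a * e^m - S(D_1 a,
  m+1) allows induction along a, D_1 a, D_1^2 a, ..., which reaches 0 because D_1 is locally
  nilpotent. Two classes in degree 1 fall outside the pattern: e^2 is killed by D_1 without being a
  value of omega, and e^1 survives because the constant 1 is not in the image of D_1. They account
  for the coefficient at \<open>{2}\<close> in the homotopy and for the special treatment of
  bidegree (1, 1).\<close>

lemma D1_induct [case_names zero step]:
  assumes "P 0" "\<And>a. P (D1 a) \<Longrightarrow> P a"
  shows "P (a :: 'k::field form)"
proof -
  obtain n where n: "(D1 ^^ n) a = 0"
    using D1_nilpotent[of a] infinite_UNIV_nat by fastforce
  have "P ((D1 ^^ (n - i)) a)" for i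
  proof (induction i)
    case 0
    then show ?case using n assms(1) by simp
  next
    case (Suc i)
    show ?case
    proof (cases "i < n")
      case True
      then have "(D1 ^^ (n - i)) a = D1 ((D1 ^^ (n - Suc i)) a)"
        by (simp flip: Suc_diff_Suc)
      with Suc assms(2) show ?thesis by metis
    qed (use Suc in simp)
  qed
  from this[of n] show ?thesis by simp
qed

lemma D1_0 [simp]: "D1 0 = 0"
  by (simp add: D1_def)

lemma D1_pow_0 [simp]: "(D1 ^^ n) 0 = 0"
  by (induction n) auto

lemma D1_uminus: "D1 (- a) = - D1 a"
  by (simp add: D1_def derivation_uminus)

lemma D1_diff: "D1 (a - b) = D1 a - D1 b"
  using D1_add[of a "- b"] by (simp add: D1_uminus)

lemma D1_pow_eventually_0: "\<exists>N. \<forall>n\<ge>N. (D1 ^^ n) (a :: 'k::field form) = 0"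
proof -
  obtain N where "\<forall>n\<in>{n. (D1 ^^ n) a \<noteq> 0}. n < N"
    using D1_nilpotent[of a] finite_nat_set_iff_bounded by blast
  then have "\<forall>n\<ge>N. (D1 ^^ n) a = 0" by force
  then show ?thesis ..
qed

text \<open>Here \<open>m\<close> is independent of the superscripts of \<open>a\<close>. This lets
  the same series serve \<open>omega\<close> and \<open>D1_inv\<close>, and lets a recursion shift
  \<open>m\<close>.\<close>

definition D1_series :: "'k::field form \<Rightarrow> nat \<Rightarrow> 'k form" where
  "D1_series a m = Sum_any (\<lambda>l. (-1) ^ l * (D1 ^^ l) a * e (m + l))"

lemma Sum_any_eq_sum_lessThan:
  "(\<And>l. N \<le> l \<Longrightarrow> f l = 0) \<Longrightarrow> Sum_any f = (\<Sum>l<N. f l)" for f :: "nat \<Rightarrow> 'a::comm_monoid_add"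
  by (rule Sum_any.expand_superset) (auto simp: not_less[symmetric])

lemma D1_series_eq_sum:
  assumes "\<And>n. N \<le> n \<Longrightarrow> (D1 ^^ n) a = 0"
  shows "D1_series a m = (\<Sum>l<N. (-1) ^ l * (D1 ^^ l) a * e (m + l))"
  unfolding D1_series_def by (rule Sum_any_eq_sum_lessThan) (simp add: assms)

lemma D1_series_0 [simp]: "D1_series 0 m = 0"
  by (simp add: D1_series_def)

text \<open>The term l = 0 is split off; what remains is the same series for \<open>D1 a\<close>,
  shifted by 1 and with the opposite sign. Induction on the nilpotency of \<open>D1\<close> then
  gives the properties of the series below.\<close>

lemma D1_series_rec: "D1_series a m = a * e m - D1_series (D1 a) (m + 1)"
proof -
  obtain N where N: "\<And>n. N \<le> n \<Longrightarrow> (D1 ^^ n) a = 0"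
    using D1_pow_eventually_0 by blast
  have "D1_series a m = (\<Sum>l<Suc N. (-1) ^ l * (D1 ^^ l) a * e (m + l))"
    by (rule D1_series_eq_sum) (simp add: N)
  also have "\<dots> = a * e m - (\<Sum>l<N. (-1) ^ l * (D1 ^^ l) (D1 a) * e (m + 1 + l))"
    by (subst sum.lessThan_Suc_shift) (simp add: funpow_swap1 sum_negf)
  also have "(\<Sum>l<N. (-1) ^ l * (D1 ^^ l) (D1 a) * e (m + 1 + l)) = D1_series (D1 a) (m + 1)"
    using N[OF le_SucI] by (intro D1_series_eq_sum[symmetric]) (simp add: funpow_swap1)
  finally show ?thesis .
qed

lemma D1_series_add: "D1_series (a + b) m = D1_series a m + D1_series b m"
proof -
  \<comment> \<open>\<open>D1_induct\<close> follows a single form; here the induction runs over an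
    exponent that kills both summands.\<close>
  have "(D1 ^^ n) a = 0 \<Longrightarrow> (D1 ^^ n) b = 0 \<Longrightarrow>
    D1_series (a + b) m = D1_series a m + D1_series b m" for n
  proof (induction n arbitrary: a b m)
    case (Suc n)
    then show ?case
      by (simp add: funpow_swap1 D1_series_rec[of "a + b" m] D1_series_rec[of a m]
          D1_series_rec[of b m] D1_add algebra_simps)
  qed simp
  moreover obtain N where "\<forall>n\<ge>N. (D1 ^^ n) a = 0"
    using D1_pow_eventually_0 by blast
  moreover obtain M where "\<forall>n\<ge>M. (D1 ^^ n) b = 0"
    using D1_pow_eventually_0 by blast
  ultimately show ?thesis using max.cobounded1[of N M] max.cobounded2[of M N] by blast
qed

lemma D1_series_scale: "D1_series (c *\<^sub>F a) m = c *\<^sub>F D1_series a m"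
proof -
  have "\<forall>m. D1_series (c *\<^sub>F a) m = c *\<^sub>F D1_series a m"
  proof (induction a rule: D1_induct)
    case (step a)
    then show ?case
      by (simp add: D1_series_rec[of a] D1_series_rec[of "c *\<^sub>F a"] D1_scale
          form.scale_right_diff_distrib)
  qed simp
  then show ?thesis ..
qed

text \<open>Telescoping: in term l + 1 the last factor e^(m+l+1) is lowered to e^(m+l), which
  cancels the part of term l where \<open>D1\<close> acts on the first factor. Only the part with
  \<open>D1 (e m)\<close> has no partner. The bound on \<open>m\<close> guarantees that e^(m+1) is
  lowered to e^m.\<close>

lemma D1_D1_series: "m \<ge> 2 \<Longrightarrow> D1 (D1_series a m) = a * D1 (e m :: 'k::field form)"
proof -
  have "\<forall>m\<ge>2. D1 (D1_series a m) = a * D1 (e m)"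
  proof (induction a rule: D1_induct)
    case (step a)
    show ?case
    proof (intro allI impI)
      fix m :: nat assume "m \<ge> 2"
      moreover from this have "D1 (e (m + 1)) = (e m :: 'k form)"
        using D1_e(3)[of "m + 1"] by simp
      ultimately have "D1 (D1_series (D1 a) (m + 1)) = D1 a * e m"
        using step by simp
      then show "D1 (D1_series a m) = a * D1 (e m)"
        by (simp add: D1_series_rec[of a m] D1_diff D1_mult)
    qed
  qed simp
  then show "m \<ge> 2 \<Longrightarrow> D1 (D1_series a m) = a * D1 (e m)" by blast
qed

text \<open>A factor killed by \<open>D1\<close> is a constant for the derivation and passes through
  all its powers. This serves multiplication by \<open>e 2\<close>.\<close>

lemma D1_series_mult_left:
  assumes "D1 x = 0"
  shows "x * D1_series a m = D1_series (x * a) m"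
proof -
  have "\<forall>m. x * D1_series a m = D1_series (x * a) m"
  proof (induction a rule: D1_induct)
    case (step a)
    then show ?case
      by (simp add: D1_series_rec[of a] D1_series_rec[of "x * a"] D1_mult assms
          right_diff_distrib mult.assoc)
  qed simp
  then show ?thesis ..
qed

lemma D1_e_small: "i < 3 \<Longrightarrow> D1 (e i) = 0"
  by (cases "i = 0") (auto simp: D1_def derivation_e monom_eq_0)

text \<open>Both sides agree on generators, and moving \<open>e 1\<close> past a generator produces
  the sign that turns the derivation \<open>D1\<close> into an antiderivation. Forms containing
  \<open>e 1\<close> are covered because \<open>D1 (e 1) = 0\<close>.\<close>

lemma d_eq_D1: "d a = e 1 * D1 (a :: 'k::field form)"
proof (induction a rule: form_induct)
  case (monom I)
  then show ?case
  proof (induction I rule: finite_linorder_min_induct)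
    case empty
    then show ?case by (simp add: monom_empty D1_def)
  next
    case (insert m I)
    have m: "m \<noteq> 0" and I: "0 \<notin> I" using insert by auto
    have mI: "monom (insert m I) = (e m * monom I :: 'k form)"
      using insert by (intro monom_insert_Min) auto
    have "d1 m = e 1 * D1 (e m :: 'k form)"
      by (cases "m \<ge> 3") (simp_all add: d1_eq D1_e D1_e_small)
    moreover have "e m * (e 1 * x) = - (e 1 * (e m * x))" for x :: "'k form"
      by (simp only: mult.assoc[symmetric] e_anticommute[of m 1] mult_minus_left)
    ultimately show ?case
      using insert.IH[OF I] by (simp add: mI d_e_mult[OF m] D1_mult distrib_left mult.assoc)
  qed
qed (simp_all add: d_add d_scale D1_add D1_scale distrib_left)

section \<open>Forms in a prescribed set of generators\<close>

lemma Lam_on_induct [consumes 1, case_names zero add scale monom]: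
  assumes "a \<in> Lam_on A q" "P 0" "\<And>a b. P a \<Longrightarrow> P b \<Longrightarrow> P (a + b)" "\<And>c a. P a \<Longrightarrow> P (c *\<^sub>F a)"
    and "\<And>I. finite I \<Longrightarrow> I \<subseteq> A \<Longrightarrow> card I = q \<Longrightarrow> P (monom I)"
  shows "P a"
  using assms(1) unfolding Lam_on_def
proof (induction rule: form.span_induct_alt)
  case base
  show ?case by (rule assms(2))
next
  case (step c x y)
  then obtain I where "x = monom I" "finite I" "I \<subseteq> A" "card I = q" by auto
  with step(2) show ?case by (simp add: assms(3-5))
qed

lemma Lam_on_subspace: "form.subspace (Lam_on A q)"
  by (simp add: Lam_on_def)

lemma Lam_on_0 [simp]: "0 \<in> Lam_on A q"
  by (simp add: form.subspace_0 Lam_on_subspace)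

lemma Lam_on_add: "a \<in> Lam_on A q \<Longrightarrow> b \<in> Lam_on A q \<Longrightarrow> a + b \<in> Lam_on A q"
  by (rule form.subspace_add[OF Lam_on_subspace])

lemma Lam_on_scale: "a \<in> Lam_on A q \<Longrightarrow> c *\<^sub>F a \<in> Lam_on A q"
  by (rule form.subspace_scale[OF Lam_on_subspace])

lemma Lam_on_diff: "a \<in> Lam_on A q \<Longrightarrow> b \<in> Lam_on A q \<Longrightarrow> a - b \<in> Lam_on A q"
  by (rule form.subspace_diff[OF Lam_on_subspace])

lemma Lam_on_mono: "a \<in> Lam_on A q \<Longrightarrow> A \<subseteq> B \<Longrightarrow> a \<in> Lam_on B q"
  unfolding in_Lam_on_iff by (meson subset_trans)

lemma monom_in_Lam_on: "I \<subseteq> A \<Longrightarrow> monom I \<in> Lam_on A (card I)"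
  by (auto simp: in_Lam_on_iff coeff_monom split: if_splits)

lemma e_in_Lam_on: "i \<in> A \<Longrightarrow> e i \<in> Lam_on A 1"
  using monom_in_Lam_on[of "{i}" A] by simp

lemma Lam_on_mult:
  assumes a: "a \<in> Lam_on A q" and b: "b \<in> Lam_on A p"
  shows "a * b \<in> Lam_on A (q + p)"
  using a
proof (induction rule: Lam_on_induct)
  case (monom I)
  show ?case using b
  proof (induction rule: Lam_on_induct)
    case m: (monom J)
    have "card (I \<union> J) = q + p" if "I \<inter> J = {}"
      using that monom m by (simp add: card_Un_disjoint)
    with monom m show ?case
      using monom_in_Lam_on[of "I \<union> J" A] by (auto simp: monom_mult intro!: Lam_on_scale)
  qed (simp_all add: distrib_left Lam_on_add Lam_on_scale)
qed (simp_all add: distrib_right Lam_on_add Lam_on_scale)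

text \<open>The condition on \<open>A\<close> is closure under lowering a superscript; every
  interval starting at 2 has it.\<close>

lemma D1_Lam_on:
  assumes A: "\<And>i. i \<in> A \<Longrightarrow> 3 \<le> i \<Longrightarrow> i - 1 \<in> A" and a: "a \<in> Lam_on A q"
  shows "D1 a \<in> Lam_on A q"
  using a
proof (induction rule: Lam_on_induct)
  case (monom I)
  then show ?case
  proof (induction I arbitrary: q rule: finite_linorder_min_induct)
    case empty
    then show ?case by (simp add: monom_empty D1_def)
  next
    case (insert m I)
    have mI: "monom (insert m I) = (e m * monom I :: 'a form)"
      using insert by (intro monom_insert_Min) auto
    have m: "m \<in> A" "m \<notin> I" and I: "(monom I :: 'a form) \<in> Lam_on A (card I)"
      using insert.prems insert.hyps monom_in_Lam_on[of I A] by auto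
    have "(D1 (e m) :: 'a form) \<in> Lam_on A 1"
      by (cases "m \<ge> 3") (use A m in \<open>simp_all add: D1_e D1_e_small e_in_Lam_on del: One_nat_def\<close>)
    then have "D1 (e m :: 'a form) * monom I \<in> Lam_on A (1 + card I)"
      using I by (rule Lam_on_mult)
    moreover have "e m * (D1 (monom I) :: 'a form) \<in> Lam_on A (1 + card I)"
      using insert m by (intro Lam_on_mult e_in_Lam_on) auto
    ultimately show ?case
      using insert.prems insert.hyps m by (auto simp: mI D1_mult intro: Lam_on_add)
  qed
qed (simp_all add: D1_add D1_scale Lam_on_add Lam_on_scale)

lemma D1_pow_Lam_on:
  "(\<And>i. i \<in> A \<Longrightarrow> 3 \<le> i \<Longrightarrow> i - 1 \<in> A) \<Longrightarrow> a \<in> Lam_on A q \<Longrightarrow> (D1 ^^ n) a \<in> Lam_on A q"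
  by (induction n) (auto intro: D1_Lam_on)

lemma monom_remove_Max:
  assumes "finite K" "K \<noteq> {}"
  shows "monom K = (monom (K - {Max K}) * e (Max K) :: 'k::field form)"
proof -
  have "monom (insert (Max K) (K - {Max K})) = (monom (K - {Max K}) * e (Max K) :: 'k form)"
    using assms by (intro monom_insert_Max) (auto simp: less_le)
  then show ?thesis using assms by (simp add: insert_absorb)
qed

lemma Lam_on_mult_e:
  assumes a: "a \<in> Lam_on A q" and A: "\<forall>j\<in>A. j < m" and "coeff (a * e m) K \<noteq> 0"
  shows "\<exists>I. finite I \<and> I \<subseteq> A \<and> card I = q \<and> K = insert m I"
proof -
  have "\<forall>K. coeff (a * e m) K \<noteq> 0 \<longrightarrow> (\<exists>I. finite I \<and> I \<subseteq> A \<and> card I = q \<and> K = insert m I)"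
    using a
  proof (induction rule: Lam_on_induct)
    case (add a b)
    show ?case
    proof (intro allI impI)
      fix K assume "coeff ((a + b) * e m) K \<noteq> 0"
      then have "coeff (a * e m) K \<noteq> 0 \<or> coeff (b * e m) K \<noteq> 0"
        by (auto simp: distrib_right)
      then show "\<exists>I. finite I \<and> I \<subseteq> A \<and> card I = q \<and> K = insert m I"
        using add by blast
    qed
  next
    case (monom I)
    then have "monom I * e m = (monom (insert m I) :: 'a form)"
      using A by (intro monom_insert_Max[symmetric]) auto
    with monom show ?case by (auto simp: coeff_monom)
  qed simp_all
  with assms(3) show ?thesis by blast
qed

lemma e_mult_swap: "e m * b = grade_sign (-1) b * (e m :: 'k::field form)"
proof (induction b rule: form_induct)
  case (monom I)
  then show ?case
  proof (induction I rule: finite_linorder_min_induct)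
    case empty
    have "grade_sign (-1) 1 = (1 :: 'k form)"
      by (rule form_eqI) (simp add: coeff_grade_sign one_form_def coeff_monom)
    then show ?case by (simp add: monom_empty)
  next
    case (insert k I)
    have I: "0 \<notin> I" using insert by auto
    have kI: "monom (insert k I) = (e k * monom I :: 'k form)"
      using insert by (intro monom_insert_Min) auto
    have "grade_sign (-1) (e k) = (-1) ^ 1 *\<^sub>F (e k :: 'k form)"
      by (rule grade_sign_eqI) (auto simp: coeff_monom split: if_splits)
    moreover have "e m * (e k * x) = - (e k * (e m * x))" for x :: "'k form"
      by (simp only: mult.assoc[symmetric] e_anticommute[of m k] mult_minus_left)
    ultimately show ?case
      using insert.IH[OF I] by (simp add: kI grade_sign_mult mult.assoc)
  qed
qed (simp_all add: grade_sign_def lin_ext_add lin_ext_scale distrib_left distrib_right)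

lemma grade_sign_Lam_on:
  assumes "b \<in> Lam_on A q"
  shows "grade_sign (-1) b = (-1) ^ q *\<^sub>F b"
  using assms by (intro grade_sign_eqI) (auto simp: in_Lam_on_iff)

lemma minus_one_power_form: "(-1) ^ n * a = (-1) ^ n *\<^sub>F (a :: 'k::field form)"
  by (cases "even n") simp_all

lemma e_mult_Lam_on: "b \<in> Lam_on A q \<Longrightarrow> e m * b = (-1) ^ q * (b * (e m :: 'k::field form))"
  by (subst e_mult_swap) (simp add: grade_sign_Lam_on minus_one_power_form)

lemma e_mult_e: "e m * b * e m = (0 :: 'k::field form)"
  by (subst e_mult_swap) (simp add: mult.assoc)

section \<open>The homotopy between the identity and omega\<close>

lemma omega_0 [simp]: "omega 0 = 0"
  by (simp add: omega_def)

lemma D1_series_in_Lam_on: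
  assumes "a \<in> Lam_on {2..} q" "m \<ge> 2"
  shows "D1_series a m \<in> Lam_on {2..} (q + 1)"
proof -
  have "\<forall>m\<ge>2. a \<in> Lam_on {2..} q \<longrightarrow> D1_series a m \<in> Lam_on {2..} (q + 1)"
  proof (induction a rule: D1_induct)
    case (step a)
    show ?case
    proof (intro allI impI)
      fix m :: nat assume m: "m \<ge> 2" and a: "a \<in> Lam_on {2..} q"
      then have "D1 a \<in> Lam_on {2..} q" by (intro D1_Lam_on) auto
      then have "D1_series (D1 a) (m + 1) \<in> Lam_on {2..} (q + 1)" using step m by simp
      moreover have "a * e m \<in> Lam_on {2..} (q + 1)"
        using a m by (intro Lam_on_mult e_in_Lam_on) auto
      ultimately show "D1_series a m \<in> Lam_on {2..} (q + 1)"
        by (subst D1_series_rec) (rule Lam_on_diff)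
    qed
  qed simp
  with assms show ?thesis by blast
qed

lemma D1_series_in_Lam:
  assumes "a \<in> Lam q k"
  shows "D1_series a m \<in> Lam (q + 1) (k + int m)"
proof -
  have "\<forall>m k. a \<in> Lam q k \<longrightarrow> D1_series a m \<in> Lam (q + 1) (k + int m)"
  proof (induction a rule: D1_induct)
    case (step a)
    show ?case
    proof (intro allI impI)
      fix m k assume a: "a \<in> Lam q k"
      then have "D1_series (D1 a) (m + 1) \<in> Lam (q + 1) (k - 1 + int (m + 1))"
        using step D1_Lam by blast
      moreover have "a * e m \<in> Lam (q + 1) (k + int m)"
        using a e_in_Lam by (rule Lam_mult)
      ultimately show "D1_series a m \<in> Lam (q + 1) (k + int m)"
        using Lam_add[OF _ Lam_uminus] by (subst D1_series_rec) fastforce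
    qed
  qed simp
  with assms show ?thesis by blast
qed

text \<open>All superscripts of \<open>a\<close> are below \<open>i\<close>, so every monomial of
  the argument has the same two largest superscripts and the series can be formed for
  \<open>a\<close> as a whole.\<close>

lemma omega_eq_D1_series:
  assumes "a \<in> Lam_on {2..i - 1} q" "i \<ge> 2"
  shows "omega (a * e i * e (i + 1)) = (D1_series (a * e i) (i + 1) :: 'k::field form)"
  using assms(1)
proof (induction rule: Lam_on_induct)
  case (monom I)
  have lt: "\<forall>j\<in>I. j < i" using monom assms(2) by (auto simp: subset_iff)
  then have 1: "monom I * e i = (monom (insert i I) :: 'k form)"
    using monom by (intro monom_insert_Max[symmetric]) auto
  have "Max (insert i I) = i"
    using lt monom by (intro Max_eqI) auto
  moreover have "0 \<notin> insert i I" using monom assms(2) by auto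
  ultimately show ?case
    unfolding 1 using omega_monom[of "insert i I", where 'k = 'k] monom
    by (simp add: D1_series_def)
qed (simp_all add: distrib_right omega_add omega_scale D1_series_add D1_series_scale)

text \<open>This is where the default value 0 of \<open>omega\<close> enters: m - 1 is missing below
  the largest superscript m. A monomial with the single superscript m counts as having a gap, hence
  \<open>omega_e2\<close>.\<close>

lemma omega_eq_0_gap:
  assumes a: "a \<in> Lam_on {..<m - 1} q"
  shows "omega (a * e m) = (0 :: 'k::field form)"
  using a
proof (induction rule: Lam_on_induct)
  case (monom I)
  show ?case
  proof (cases "0 \<in> insert m I")
    case True
    then show ?thesis by (auto simp: monom_eq_0)
  next
    case False
    have lt: "\<forall>j\<in>I. j + 1 < m" using monom by auto
    then have 1: "monom I * e m = (monom (insert m I) :: 'k form)"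
      using monom by (intro monom_insert_Max[symmetric]) auto
    have 2: "Max (insert m I) = m"
      using lt monom by (intro Max_eqI) force+
    have 3: "insert m I - {m} = I" using lt by auto
    have "m \<noteq> Max I + 1" if "I \<noteq> {}"
      using Max_in[OF _ that] lt monom by auto
    moreover have "omega (monom (insert m I)) = (let m' = Max (insert m I); J = insert m I - {m'} in
        if J \<noteq> {} \<and> m' = Max J + 1
        then Sum_any (\<lambda>l. (-1) ^ l * (D1 ^^ l) (monom J) * e (m' + l)) else (0 :: 'k form))"
      unfolding omega_def by (rule lin_ext_monom) (use False monom(1) in auto)
    ultimately show ?thesis unfolding 1 2 Let_def 3 by auto
  qed
qed (simp_all add: distrib_right omega_add omega_scale)

lemma omega_e2: "omega (e 2) = 0"
  using omega_eq_0_gap[OF monom_in_Lam_on[of "{}" "{..<2 - 1}"]] by (simp add: monom_empty)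

text \<open>By telescoping, only \<open>monom I * D1 (e (Max I + 1))\<close> survives. It is
  \<open>monom I * e (Max I)\<close>, which repeats a factor, or 0 at once if \<open>Max I\<close>
  is 1.\<close>

lemma D1_omega: "D1 (omega a) = (0 :: 'k::field form)"
proof (induction a rule: form_induct)
  case (monom K)
  show ?case
  proof (cases "K - {Max K} \<noteq> {} \<and> Max K = Max (K - {Max K}) + 1")
    case True
    define I where "I = K - {Max K}"
    have I: "finite I" "I \<noteq> {}" "0 \<notin> I" and m: "Max K = Max I + 1"
      using monom True by (auto simp: I_def)
    have "K \<noteq> {}" using True by auto
    then have "monom K = (monom I * e (Max I + 1) :: 'k form)"
      unfolding m[symmetric] unfolding I_def by (rule monom_remove_Max[OF monom(1)])
    then have "omega (monom K) = (D1_series (monom I) (Max I + 1) :: 'k form)"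
      using omega_monom[OF I, where 'k = 'k] by (simp add: D1_series_def)
    moreover have "Max I \<noteq> 0" using Max_in[OF I(1,2)] I(3) by metis
    moreover have "monom I * e (Max I) = (0 :: 'k form)"
      using Max_in[OF I(1,2)] I(1) by (simp add: monom_mult)
    ultimately show ?thesis
      by (cases "Max I \<ge> 2") (simp_all add: D1_D1_series D1_e D1_e_small)
  next
    case False
    then have "omega (monom K) = (0 :: 'k form)"
      unfolding omega_def using monom by (subst lin_ext_monom) (auto simp: Let_def)
    then show ?thesis by simp
  qed
qed (simp_all add: omega_add omega_scale D1_add D1_scale)

lemma d_omega: "d (omega a) = 0"
  by (simp add: d_eq_D1 D1_omega)

text \<open>The D_{-1} of the overview. The value at \<open>{}\<close> is a mere default:
  \<open>D1\<close> preserves the degree and kills constants, so 1 has no preimage.\<close>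

definition D1_inv :: "'k::field form \<Rightarrow> 'k form" where
  "D1_inv = lin_ext (\<lambda>K. if K = {} then 0 else D1_series (monom (K - {Max K})) (Max K + 1))"

lemma D1_inv_add: "D1_inv (a + b) = D1_inv a + D1_inv b"
  by (simp add: D1_inv_def lin_ext_add)

lemma D1_inv_scale: "D1_inv (c *\<^sub>F a) = c *\<^sub>F D1_inv a"
  by (simp add: D1_inv_def lin_ext_scale)

lemma D1_inv_0 [simp]: "D1_inv 0 = 0"
  by (simp add: D1_inv_def)

lemma D1_inv_mult_e:
  assumes "a \<in> Lam_on {2..<m} q" "m \<ge> 2"
  shows "D1_inv (a * e m) = (D1_series a (m + 1) :: 'k::field form)"
  using assms(1)
proof (induction rule: Lam_on_induct)
  case (monom I)
  have lt: "\<forall>j\<in>I. j < m" using monom by auto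
  then have 1: "monom I * e m = (monom (insert m I) :: 'k form)"
    using monom by (intro monom_insert_Max[symmetric]) auto
  have 2: "Max (insert m I) = m"
    using lt monom by (intro Max_eqI) force+
  have 3: "insert m I - {m} = I" using lt by auto
  have "0 \<notin> insert m I" using monom assms(2) by auto
  then show ?case unfolding 1 D1_inv_def using monom(1)
    by (subst lin_ext_monom) (simp_all add: 2 3 del: Diff_insert0)
qed (simp_all add: distrib_right D1_inv_add D1_inv_scale D1_series_add D1_series_scale)

text \<open>Monomials come with the largest superscript split off, the shape in which
  \<open>omega\<close> and \<open>D1_inv\<close> are given.\<close>

lemma Lam_on_pos_induct [consumes 2, case_names zero add scale monom]:
  assumes "a \<in> Lam_on {2..} q" "q \<ge> 1" "P 0" "\<And>a b. P a \<Longrightarrow> P b \<Longrightarrow> P (a + b)"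
    "\<And>c a. P a \<Longrightarrow> P (c *\<^sub>F a)"
    and "\<And>I m. finite I \<Longrightarrow> I \<subseteq> {2..<m} \<Longrightarrow> 2 \<le> m \<Longrightarrow> card I = q - 1 \<Longrightarrow> P (monom I * e m)"
  shows "P (a :: 'k::field form)"
  using assms(1)
proof (induction rule: Lam_on_induct)
  case (monom K)
  have K: "K \<noteq> {}" using assms(2) monom by auto
  have "K - {Max K} \<subseteq> {2..<Max K}" using monom by (auto simp: less_le)
  moreover have "2 \<le> Max K" using Max_in[OF monom(1) K] monom by auto
  moreover have "card (K - {Max K}) = q - 1" using K monom by simp
  ultimately show ?case
    unfolding monom_remove_Max[OF monom(1) K, where 'k = 'k] using monom(1) by (intro assms(6)) auto
qed (use assms in auto)

lemma D1_D1_inv: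
  assumes "a \<in> Lam_on {2..} q" "q \<ge> 1"
  shows "D1 (D1_inv a) = (a :: 'k::field form)"
  using assms
proof (induction rule: Lam_on_pos_induct)
  case (monom I m)
  have "monom I \<in> Lam_on {2..<m} (card I)" using monom(2) by (rule monom_in_Lam_on)
  then have "D1_inv (monom I * e m) = (D1_series (monom I) (m + 1) :: 'k form)"
    using monom(3) by (rule D1_inv_mult_e)
  then show ?case using monom(3) by (simp add: D1_D1_series D1_e)
qed (simp_all add: D1_inv_add D1_inv_scale D1_add D1_scale)

text \<open>For x = \<open>monom I\<close> and m at least 3, \<open>D1 (x * e m)\<close> is
  \<open>D1 x * e m + x * e (m - 1)\<close>. \<open>D1_inv\<close> sends the first summand to
  \<open>D1_series (D1 x) (m + 1)\<close>, and by the recursion \<open>D1_series x m\<close> is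
  still missing. If m - 1 is in \<open>I\<close>, the second summand vanishes and
  \<open>omega\<close> supplies the missing series; otherwise \<open>omega\<close> vanishes and
  \<open>D1_inv\<close> of the second summand supplies it. For m = 2 the form is \<open>e 2\<close>,
  killed by both operators, whence the coefficient at \<open>{2}\<close>.\<close>

lemma D1_homotopy:
  assumes "a \<in> Lam_on {2..} q" "q \<ge> 1"
  shows "omega a + coeff a {2} *\<^sub>F e 2 + D1_inv (D1 a) = (a :: 'k::field form)"
  using assms
proof (induction rule: Lam_on_pos_induct)
  case (add a b)
  have "omega (a + b) + coeff (a + b) {2} *\<^sub>F e 2 + D1_inv (D1 (a + b)) =
     (omega a + coeff a {2} *\<^sub>F e 2 + D1_inv (D1 a)) + (omega b + coeff b {2} *\<^sub>F e 2 + D1_inv (D1 b))"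
    by (simp add: omega_add D1_add D1_inv_add form.scale_left_distrib)
  then show ?case by (simp only: add)
next
  case (scale c a)
  have "omega (c *\<^sub>F a) + coeff (c *\<^sub>F a) {2} *\<^sub>F e 2 + D1_inv (D1 (c *\<^sub>F a)) =
     c *\<^sub>F (omega a + coeff a {2} *\<^sub>F e 2 + D1_inv (D1 a))"
    by (simp add: omega_scale D1_scale D1_inv_scale form.scale_right_distrib)
  then show ?case by (simp only: scale)
next
  case (monom I m)
  let ?a = "monom I :: 'k form"
  have a: "?a \<in> Lam_on {2..<m} (card I)" using monom(2) by (rule monom_in_Lam_on)
  then have "D1 ?a \<in> Lam_on {2..<m} (card I)" by (intro D1_Lam_on) auto
  then have 1: "D1_inv (D1 ?a * e m) = D1_series (D1 ?a) (m + 1)"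
    using monom(3) by (rule D1_inv_mult_e)
  have 2: "?a * e m = D1_series ?a m + D1_series (D1 ?a) (m + 1)"
    using D1_series_rec[of ?a m] by simp
  have mI: "?a * e m = monom (insert m I)"
    using monom by (intro monom_insert_Max[symmetric]) auto
  show ?case
  proof (cases "m = 2")
    case True
    then have "I = {}" using monom(2) by auto
    then show ?thesis using True
      by (simp add: monom_empty omega_e2 D1_e coeff_monom)
  next
    case False
    then have m: "m \<ge> 3" "m - 1 + 1 = m" using monom(3) by auto
    have D: "D1 (?a * e m) = D1 ?a * e m + ?a * e (m - 1)"
      using m by (simp add: D1_mult D1_e)
    have "insert m I \<noteq> {2}" using False by auto
    then have c: "coeff (?a * e m) {2} = 0"
      unfolding mI by (auto simp: coeff_monom)
    show ?thesis
    proof (cases "m - 1 \<in> I")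
      case True
      define J where "J = I - {m - 1}"
      have J: "I = insert (m - 1) J" "finite J" "J \<subseteq> {2..m - 1 - 1}"
        using True monom by (auto simp: J_def subset_iff)
      then have aJ: "?a = monom J * e (m - 1)"
        unfolding J(1) using m by (intro monom_insert_Max) (auto simp: subset_iff)
      have "omega (?a * e m) = D1_series ?a m"
        using omega_eq_D1_series[OF monom_in_Lam_on[OF J(3)], where 'k = 'k] m aJ by simp
      moreover have "?a * e (m - 1) = 0"
        by (simp add: aJ mult.assoc)
      ultimately have "omega (?a * e m) + coeff (?a * e m) {2} *\<^sub>F e 2 + D1_inv (D1 (?a * e m)) =
          D1_series ?a m + D1_series (D1 ?a) (m + 1)"
        by (simp only: D c 1 add_0_right form.scale_zero_left)
      then show ?thesis by (simp only: 2[symmetric])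
    next
      case nm: False
      have "I \<subseteq> {..<m - 1}" 
      proof
        fix j assume "j \<in> I"
        with nm monom(2) have "j < m" "j \<noteq> m - 1" by auto
        then show "j \<in> {..<m - 1}" by simp
      qed
      then have "omega (?a * e m) = 0"
        by (rule omega_eq_0_gap[OF monom_in_Lam_on])
      moreover have "I \<subseteq> {2..<m - 1}" using \<open>I \<subseteq> {..<m - 1}\<close> monom(2)
        by (simp add: subset_iff)
      then have "D1_inv (?a * e (m - 1)) = D1_series ?a (m - 1 + 1)"
        using m by (intro D1_inv_mult_e[OF monom_in_Lam_on]) auto
      ultimately have "omega (?a * e m) + coeff (?a * e m) {2} *\<^sub>F e 2 + D1_inv (D1 (?a * e m)) =
          D1_series ?a m + D1_series (D1 ?a) (m + 1)"
        using m by (simp only: D c 1 D1_inv_add) simp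
      then show ?thesis by (simp only: 2[symmetric])
    qed
  qed
qed simp

section \<open>The multiplicative structure\<close>

lemma omega_fixes_ker_D1:
  assumes "a \<in> Lam_on {2..} q" "q \<ge> 2" "D1 a = 0"
  shows "omega a = (a :: 'k::field form)"
proof -
  have "coeff a {2} = 0" using assms by (force simp: in_Lam_on_iff)
  then show ?thesis using D1_homotopy[OF assms(1)] assms by simp
qed

lemma omega_in_Lam_on:
  assumes "a \<in> Lam_on {2..i - 1} q" "i \<ge> 2"
  shows "omega (a * e i * e (i + 1)) \<in> (Lam_on {2..} (q + 2) :: 'k::field form set)"
proof -
  have "a * e i \<in> Lam_on {2..} (q + 1)"
    using assms by (intro Lam_on_mult e_in_Lam_on Lam_on_mono[OF assms(1)]) auto
  then show ?thesis
    using D1_series_in_Lam_on[of "a * e i" "q + 1" "i + 1"] omega_eq_D1_series[OF assms] assms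
    by simp
qed

lemma cls_eq_0I:
  assumes "x = d c"
  shows "cls x = 0"
  using cls_eq_iff[of x 0] assms by (simp add: cls_01 d_d)

text \<open>Since \<open>D1\<close> is onto in positive degree,
  \<open>e 1 * a = e 1 * D1 (D1_inv a)\<close> is exact.\<close>

lemma cls_e1_mult:
  assumes "a \<in> Lam_on {2..} q" "q \<ge> 1" "D1 a = 0"
  shows "cls (e 1) * cls a = (0 :: 'k::field coh)"
proof -
  have "e 1 * a = d (D1_inv a)"
    using D1_D1_inv[OF assms(1,2)] by (simp add: d_eq_D1)
  moreover have "cls (e 1) * cls a = cls (e 1 * a)"
    using assms(3) by (intro cls_simps) (simp_all add: d_eq_D1 D1_e del: One_nat_def)
  ultimately show ?thesis by (simp add: cls_eq_0I)
qed

lemma e2_mult_omega: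
  assumes xi: "xi \<in> Lam_on {2..i - 1} p" and i: "i \<ge> 2"
  shows "e 2 * omega (xi * e i * e (i + 1)) = (omega (e 2 * xi * e i * e (i + 1)) :: 'k::field form)"
proof (cases "i = 2")
  case True
  have "e 2 * (xi * e i) = 0" using e_mult_e[of 2 xi] True by (simp add: mult.assoc)
  moreover from this have "e 2 * xi * e i * e (i + 1) = 0" by (simp add: mult.assoc[symmetric])
  ultimately show ?thesis
    using omega_eq_D1_series[OF xi i] by (simp add: D1_series_mult_left D1_e)
next
  case False
  with i have "e 2 * xi \<in> Lam_on {2..i - 1} (1 + p)"
    by (intro Lam_on_mult e_in_Lam_on xi) auto
  then have "omega (e 2 * xi * e i * e (i + 1)) = D1_series (e 2 * xi * e i) (i + 1)"
    using i by (rule omega_eq_D1_series)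
  then show ?thesis
    using omega_eq_D1_series[OF xi i] by (simp add: D1_series_mult_left D1_e mult.assoc)
qed

lemma omega_uminus: "omega (- a) = - omega a"
  by (simp add: omega_def lin_ext_uminus)

lemma omega_sum: "omega (sum f S) = (\<Sum>x\<in>S. omega (f x))"
  by (induction S rule: infinite_finite_induct) (simp_all add: omega_add)

lemma cls_minus_one_power:
  assumes "d a = 0"
  shows "d ((-1) ^ n * a) = 0" "cls ((-1) ^ n * a) = (-1) ^ n * cls a"
  using assms by (cases "even n"; simp add: d_uminus cls_simps)+

lemma D1_pow_in_interval:
  "a \<in> Lam_on {2..i} q \<Longrightarrow> (D1 ^^ n) a \<in> Lam_on {2..i} q" for i :: nat
  by (rule D1_pow_Lam_on) auto

text \<open>The product formula holds for the cocycles themselves. The product lies in the kernel of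
  \<open>D1\<close> and has degree at least 4, so it is its own image under \<open>omega\<close>,
  and this image is computed on the double series term by term. \<open>N\<close> truncates the
  series.\<close>

lemma omega_product_form:
  fixes xi eta :: "'k::field form"
  assumes i: "2 \<le> i" and ij: "i \<le> j"
    and xi: "xi \<in> Lam_on {2..i - 1} p" and eta: "eta \<in> Lam_on {2..j - 1} r"
    and N: "\<And>n. N \<le> n \<Longrightarrow> (D1 ^^ n) (xi * e i) = 0" "\<And>n. N \<le> n \<Longrightarrow> (D1 ^^ n) (eta * e j) = 0"
  shows "omega (xi * e i * e (i + 1)) * omega (eta * e j * e (j + 1)) =
      (\<Sum>l = 0..j - i + 1. (-1) ^ l *
         omega ((D1 ^^ l) (xi * e i) * e (i + 1 + l) * eta * e j * e (j + 1))) +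
      (-1) ^ (j - i + r) * (\<Sum>s<N. if s \<ge> 1 then
         omega ((D1 ^^ (j - i + s - 1)) (xi * e i) * (D1 ^^ s) (eta * e j) *
           e (j + s) * e (j + s + 1)) else 0) +
      (-1) ^ (j - i + r + 1) * (\<Sum>s<N. if s \<ge> 1 then
         omega ((D1 ^^ (j - i + 1 + s)) (xi * e i) * (D1 ^^ s) (eta * e j) *
           e (j + s + 1) * e (j + s + 2)) else 0)" (is "_ = ?S0 + ?c1 * (\<Sum>s<N. if s \<ge> 1 then ?g1 s else 0) +
      ?c2 * (\<Sum>s<N. if s \<ge> 1 then ?g2 s else 0)")
proof -
  define a where "a l = (D1 ^^ l) (xi * e i)" for l
  define b where "b s = (D1 ^^ s) (eta * e j)" for s
  \<comment> \<open>Large enough to contain the index j - i + 1 + s for every s < N.\<close>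
  define L where "L = j - i + 1 + N"
  have "xi * e i \<in> Lam_on {2..i} (p + 1)"
    using i by (intro Lam_on_mult e_in_Lam_on Lam_on_mono[OF xi]) auto
  then have a: "a l \<in> Lam_on {2..i} (p + 1)" for l
    unfolding a_def by (rule D1_pow_in_interval)
  have "eta * e j \<in> Lam_on {2..j} (r + 1)"
    using i ij by (intro Lam_on_mult e_in_Lam_on Lam_on_mono[OF eta]) auto
  then have b: "b s \<in> Lam_on {2..j} (r + 1)" for s
    unfolding b_def by (rule D1_pow_in_interval)
  define t where "t l s = a l * e (i + 1 + l) * (b s * e (j + 1 + s))" for l s
  \<comment> \<open>e^(i+1+l) passes \<open>b s\<close>, which has degree r + 1. With both single
    superscripts at the end, the comparison of i + l with j + s decides which one is the
    largest.\<close>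
  have t_swap: "t l s = (-1) ^ (r + 1) * (a l * b s * e (i + 1 + l) * e (j + 1 + s))" for l s
  proof -
    have "t l s = a l * (e (i + 1 + l) * b s) * e (j + 1 + s)"
      by (simp add: t_def mult.assoc)
    also have "e (i + 1 + l) * b s = (-1) ^ (r + 1) * (b s * e (i + 1 + l))"
      using b by (rule e_mult_Lam_on)
    finally show ?thesis by (simp add: minus_one_power_form mult.assoc del: power_Suc)
  qed
  have t_equal: "t l s = 0" if "i + l = j + s" for l s
    using that by (simp add: t_swap mult.assoc)
  \<comment> \<open>For s = 0 the factor e^j stands next to e^(j+1) and there is no gap; this is why
    the terms with s = 0 form a sum of their own.\<close>
  have t_low: "omega (t l s) = 0" if "s \<ge> 1" "i + 1 + l < j + s" for l s
  proof -
    have "a l * e (i + 1 + l) * b s \<in> Lam_on {..<j + 1 + s - 1} (p + 1 + 1 + (r + 1))"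
      using that i ij by (intro Lam_on_mult e_in_Lam_on Lam_on_mono[OF a] Lam_on_mono[OF b]) auto
    from omega_eq_0_gap[OF this] show ?thesis by (simp add: t_def mult.assoc)
  qed
  \<comment> \<open>This also holds for s = 0, where it ends the first sum at l = j - i + 1.\<close>
  have t_high: "omega (t l s) = 0" if "i + l > j + s + 1" for l s
  proof -
    have "a l * b s * e (j + 1 + s) \<in> Lam_on {..<i + 1 + l - 1} (p + 1 + (r + 1) + 1)"
      using that i ij by (intro Lam_on_mult e_in_Lam_on Lam_on_mono[OF a] Lam_on_mono[OF b]) auto
    from omega_eq_0_gap[OF this] have "omega (a l * b s * e (i + 1 + l) * e (j + 1 + s)) = 0"
      using omega_scale[of "-1" "a l * b s * e (j + 1 + s) * e (i + 1 + l)"]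
        e_anticommute[of "i + 1 + l" "j + 1 + s", where 'k = 'k] by (simp add: mult.assoc)
    then show ?thesis by (simp add: t_swap minus_one_power_form omega_scale del: power_Suc)
  qed
  text \<open>So the only terms with $s \ge 1$ that survive under \<open>omega\<close> have $i + l = j + s \pm 1$.\<close>
  define f where "f l s = (-1) ^ (l + s) *\<^sub>F omega (t l s)" for l s
  have f0: "(\<Sum>l<L. f l 0) = ?S0"
  proof -
    have "(\<Sum>l<L. f l 0) = (\<Sum>l\<in>{0..j - i + 1}. f l 0)"
    proof (rule sum.mono_neutral_cong)
      fix l assume "l \<in> {..<L} - {0..j - i + 1}"
      then have "i + l > j + 0 + 1" using ij by auto
      then show "f l 0 = 0" unfolding f_def by (simp add: t_high)
    next
      fix l assume "l \<in> {0..j - i + 1} - {..<L}"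
      then have "a l = 0" unfolding a_def L_def by (intro N) auto
      then show "f l 0 = 0" by (simp add: f_def t_def)
    qed auto
    also have "\<dots> = ?S0"
      by (simp add: f_def t_def a_def b_def minus_one_power_form mult.assoc)
    finally show ?thesis .
  qed
  have fs: "(\<Sum>l<L. f l s) = ?c1 * ?g1 s + ?c2 * ?g2 s" if s: "s \<ge> 1" "s < N" for s
  proof -
    \<comment> \<open>The indices for which e^(i+1+l) is the lower, respectively the upper,
      neighbour of e^(j+1+s). Since s is at least 1, the natural subtraction is exact even for i =
      j.\<close>
    define l1 l2 where "l1 = j - i + s - 1" and "l2 = j - i + 1 + s"
    have l: "i + 1 + l1 = j + s" "i + 1 + l2 = j + s + 2" "l1 \<noteq> l2"
      using s ij by (auto simp: l1_def l2_def)
    have "(\<Sum>l<L. f l s) = (\<Sum>l\<in>{l1, l2}. f l s)"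
    proof (rule sum.mono_neutral_right)
      show "{l1, l2} \<subseteq> {..<L}" using s by (auto simp: l1_def l2_def L_def)
      show "\<forall>l\<in>{..<L} - {l1, l2}. f l s = 0"
      proof
        fix l assume "l \<in> {..<L} - {l1, l2}"
        then have "i + 1 + l < j + s \<or> i + l = j + s \<or> i + l > j + s + 1" using l by auto
        then show "f l s = 0" unfolding f_def using t_low t_equal t_high s(1) by auto
      qed
    qed simp
    also have "\<dots> = f l1 s + f l2 s" using l(3) by simp
    also have "f l1 s = ?c1 * ?g1 s"
    proof -
      have "(-1) ^ (l1 + s) * (-1) ^ (r + 1) = ((-1) ^ (j - i + r) :: 'k)"
      proof -
        have "l1 + s + (r + 1) = (j - i + r) + 2 * s" using s by (simp add: l1_def)
        then have "(-1) ^ (l1 + s + (r + 1)) = ((-1) ^ (j - i + r + 2 * s) :: 'k)" by (rule arg_cong)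
        then show ?thesis by (simp only: power_add[symmetric]) (simp add: power_add power_mult)
      qed
      then show ?thesis
        unfolding f_def t_swap l(1)
        by (simp add: minus_one_power_form omega_scale a_def b_def l1_def add_ac del: power_Suc)
    qed
    also have "f l2 s = ?c2 * ?g2 s"
    proof -
      have "(-1) ^ (l2 + s) * (-1) ^ (r + 1) = - ((-1) ^ (j - i + r + 1) :: 'k)"
      proof -
        have "l2 + s + (r + 1) = (j - i + r + 1) + 1 + 2 * s" by (simp add: l2_def)
        then have "(-1) ^ (l2 + s + (r + 1)) = ((-1) ^ (j - i + r + 1 + 1 + 2 * s) :: 'k)" by (rule arg_cong)
        then show ?thesis by (simp only: power_add[symmetric]) (simp add: power_add power_mult)
      qed
      \<comment> \<open>Here the larger superscript comes first; sorting the pair costs the sign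
        that is missing above.\<close>
      moreover have "a l2 * b s * e (i + 1 + l2) * e (j + 1 + s) =
          (-1) *\<^sub>F (a l2 * b s * e (j + s + 1) * e (j + s + 2))"
        using l(2) e_anticommute[of "i + 1 + l2" "j + s + 1", where 'k = 'k]
        by (simp add: mult.assoc)
      ultimately show ?thesis
        unfolding f_def t_swap
        by (simp add: minus_one_power_form omega_scale omega_uminus a_def b_def l2_def del: power_Suc)
    qed
    finally show ?thesis .
  qed
  let ?x = "omega (xi * e i * e (i + 1))" and ?y = "omega (eta * e j * e (j + 1))"
  have "?x * ?y \<in> Lam_on {2..} (p + 2 + (r + 2))"
    using assms by (intro Lam_on_mult omega_in_Lam_on) auto
  moreover have "D1 (?x * ?y) = 0" by (simp add: D1_mult D1_omega)
  ultimately have "?x * ?y = omega (?x * ?y)"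
    by (intro omega_fixes_ker_D1[symmetric]) auto
  also have "\<dots> = (\<Sum>l<L. \<Sum>s<N. f l s)"
  proof -
    have "?x = (\<Sum>l<L. (-1) ^ l * a l * e (i + 1 + l))"
      unfolding omega_eq_D1_series[OF xi i] a_def
      by (rule D1_series_eq_sum) (rule N, simp add: L_def)
    moreover have "?y = (\<Sum>s<N. (-1) ^ s * b s * e (j + 1 + s))"
      unfolding omega_eq_D1_series[OF eta order_trans[OF i ij]] b_def
      by (rule D1_series_eq_sum) (rule N)
    ultimately show ?thesis
      by (simp add: sum_product omega_sum f_def t_def mult.assoc minus_one_power_form omega_scale
          power_add mult.commute)
  qed
  also have "\<dots> = (\<Sum>s<N. \<Sum>l<L. f l s)" by (rule sum.swap)
  also have "\<dots> = (\<Sum>s<N. (if s = 0 then ?S0 else 0) + (if s \<ge> 1 then ?c1 * ?g1 s else 0) +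
      (if s \<ge> 1 then ?c2 * ?g2 s else 0))"
  proof (intro sum.cong refl)
    fix s assume "s \<in> {..<N}"
    then show "(\<Sum>l<L. f l s) = (if s = 0 then ?S0 else 0) + (if s \<ge> 1 then ?c1 * ?g1 s else 0) +
      (if s \<ge> 1 then ?c2 * ?g2 s else 0)"
    proof (cases "s = 0")
      case True
      then show ?thesis by (simp only: f0) simp
    next
      case False
      then have s: "s \<ge> 1" "s < N" using \<open>s \<in> {..<N}\<close> by auto
      show ?thesis unfolding fs[OF s] using s by (simp only: if_P if_not_P False add_0_left simp_thms)
    qed
  qed
  also have "\<dots> = (if 0 < N then ?S0 else 0) + (\<Sum>s<N. if s \<ge> 1 then ?c1 * ?g1 s else 0) +
      (\<Sum>s<N. if s \<ge> 1 then ?c2 * ?g2 s else 0)"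
    by (simp only: sum.distrib) (simp add: sum.delta)
  \<comment> \<open>For N = 0 the sum over s lacks even s = 0, but then all \<open>a l\<close>
    vanish and \<open>?S0\<close> with them.\<close>
  also have "(if 0 < N then ?S0 else 0) = ?S0"
  proof (cases "N = 0")
    case True
    then have "a l = 0" for l using N(1) by (simp add: a_def)
    then show ?thesis using True by (simp add: a_def)
  qed simp
  also have "(\<Sum>s<N. if s \<ge> 1 then ?c1 * ?g1 s else 0) = ?c1 * (\<Sum>s<N. if s \<ge> 1 then ?g1 s else 0)"
    unfolding sum_distrib_left by (intro sum.cong) auto
  also have "(\<Sum>s<N. if s \<ge> 1 then ?c2 * ?g2 s else 0) = ?c2 * (\<Sum>s<N. if s \<ge> 1 then ?g2 s else 0)"
    unfolding sum_distrib_left by (intro sum.cong) auto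
  finally show ?thesis .
qed

text \<open>\<open>cls\<close> is compatible with sums of cocycles, so each of the three sums is
  first seen to be closed; a common bound for the nilpotency of both factors makes the
  \<open>Sum_any\<close> finite sums.\<close>

lemma cls_omega_mult:
  fixes xi eta :: "'k::field form"
  assumes i: "2 \<le> i" and ij: "i \<le> j"
    and xi: "xi \<in> Lam_on {2..i - 1} p" and eta: "eta \<in> Lam_on {2..j - 1} r"
  shows "cls (omega (xi * e i * e (i + 1))) * cls (omega (eta * e j * e (j + 1))) =
      (\<Sum>l = 0..j - i + 1. (-1) ^ l *
         cls (omega ((D1 ^^ l) (xi * e i) * e (i + 1 + l) * eta * e j * e (j + 1)))) +
      (-1) ^ (j - i + r) * Sum_any (\<lambda>s. if s \<ge> 1 then
         cls (omega ((D1 ^^ (j - i + s - 1)) (xi * e i) * (D1 ^^ s) (eta * e j) *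
           e (j + s) * e (j + s + 1))) else 0) +
      (-1) ^ (j - i + r + 1) * Sum_any (\<lambda>s. if s \<ge> 1 then
         cls (omega ((D1 ^^ (j - i + 1 + s)) (xi * e i) * (D1 ^^ s) (eta * e j) *
           e (j + s + 1) * e (j + s + 2))) else 0)"
    (is "_ = (\<Sum>l = 0..j - i + 1. (-1) ^ l * cls (omega (?g0 l))) +
      (-1) ^ (j - i + r) * Sum_any (\<lambda>s. if s \<ge> 1 then cls (omega (?g1 s)) else 0) +
      (-1) ^ (j - i + r + 1) * Sum_any (\<lambda>s. if s \<ge> 1 then cls (omega (?g2 s)) else 0)")
proof -
  obtain N1 where N1: "\<forall>n\<ge>N1. (D1 ^^ n) (xi * e i) = 0"
    using D1_pow_eventually_0 by blast
  obtain N2 where N2: "\<forall>n\<ge>N2. (D1 ^^ n) (eta * e j) = 0"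
    using D1_pow_eventually_0 by blast
  define N where "N = max N1 N2"
  have N: "(D1 ^^ n) (xi * e i) = 0" "(D1 ^^ n) (eta * e j) = 0" if "N \<le> n" for n
    using N1 N2 that by (auto simp: N_def)
  define S0 where "S0 = (\<Sum>l = 0..j - i + 1. (-1) ^ l * omega (?g0 l))"
  have S0: "d S0 = 0 \<and> cls S0 = (\<Sum>l = 0..j - i + 1. cls ((-1) ^ l * omega (?g0 l)))"
    unfolding S0_def by (rule cls_sum) (simp add: cls_minus_one_power(1) d_omega)
  have S: "d (\<Sum>s<N. if s \<ge> 1 then omega (g s) else 0) = 0 \<and>
      cls (\<Sum>s<N. if s \<ge> 1 then omega (g s) else 0) =
      Sum_any (\<lambda>s. if s \<ge> 1 then cls (omega (g s)) else 0)"
    if "\<And>s. N \<le> s \<Longrightarrow> g s = 0" for g :: "nat \<Rightarrow> 'k form"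
  proof -
    have "d (\<Sum>s<N. if s \<ge> 1 then omega (g s) else 0) = 0 \<and>
      cls (\<Sum>s<N. if s \<ge> 1 then omega (g s) else 0) = (\<Sum>s<N. cls (if s \<ge> 1 then omega (g s) else 0))"
      by (rule cls_sum) (simp add: d_omega)
    moreover have "Sum_any (\<lambda>s. if s \<ge> 1 then cls (omega (g s)) else 0) =
      (\<Sum>s<N. if s \<ge> 1 then cls (omega (g s)) else 0)"
      by (rule Sum_any_eq_sum_lessThan) (simp add: that cls_01)
    ultimately show ?thesis by (simp add: if_distrib[of cls] cls_01 cong: if_cong)
  qed
  define G1 where "G1 = (\<Sum>s<N. if s \<ge> 1 then omega (?g1 s) else 0)"
  define G2 where "G2 = (\<Sum>s<N. if s \<ge> 1 then omega (?g2 s) else 0)"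
  have G1: "d G1 = 0 \<and> cls G1 = Sum_any (\<lambda>s. if s \<ge> 1 then cls (omega (?g1 s)) else 0)"
    unfolding G1_def by (rule S) (simp add: N)
  have G2: "d G2 = 0 \<and> cls G2 = Sum_any (\<lambda>s. if s \<ge> 1 then cls (omega (?g2 s)) else 0)"
    unfolding G2_def by (rule S) (simp add: N)
  have lin: "cls (a + (-1) ^ m * b + (-1) ^ n * c) = cls a + (-1) ^ m * cls b + (-1) ^ n * cls c"
    if "d a = 0" "d b = 0" "d c = 0" for a b c :: "'k form" and m n
    using that cls_simps(1)[of "a + (-1) ^ m * b" "(-1) ^ n * c"] cls_simps(1)[of a "(-1) ^ m * b"]
    by (simp add: cls_minus_one_power d_add)
  have "cls (omega (xi * e i * e (i + 1))) * cls (omega (eta * e j * e (j + 1))) =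
      cls (omega (xi * e i * e (i + 1)) * omega (eta * e j * e (j + 1)))"
    by (rule cls_simps) (rule d_omega)+
  also have "\<dots> = cls (S0 + (-1) ^ (j - i + r) * G1 + (-1) ^ (j - i + r + 1) * G2)"
    unfolding S0_def G1_def G2_def by (rule arg_cong[OF omega_product_form[OF assms N]])
  also have "\<dots> = cls S0 + (-1) ^ (j - i + r) * cls G1 + (-1) ^ (j - i + r + 1) * cls G2"
    using S0 G1 G2 by (intro lin) blast+
  also have "cls S0 = (\<Sum>l = 0..j - i + 1. (-1) ^ l * cls (omega (?g0 l)))"
    by (simp only: S0 cls_minus_one_power(2) d_omega)
  finally show ?thesis by (simp only: G1 G2)
qed

section \<open>Counting monomials\<close>

definition mono_sets :: "nat \<Rightarrow> int \<Rightarrow> nat set set" where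
  "mono_sets q n = {K. finite K \<and> K \<subseteq> {2..} \<and> card K = q \<and> int (\<Sum>K) = n}"

text \<open>The second alternative means that the two largest superscripts are consecutive. The set \<open>{2}\<close>
  is included as if 1 preceded 2; it accounts for the class of $e^2$.\<close>

definition top_pair :: "nat set \<Rightarrow> bool" where
  "top_pair K \<longleftrightarrow> Max K = 2 \<or> Max K - 1 \<in> K"

lemma finite_mono_sets: "finite (mono_sets q n)"
proof (rule finite_subset)
  show "mono_sets q n \<subseteq> Pow {..nat n}"
  proof
    fix K assume K: "K \<in> mono_sets q n"
    have "i \<le> nat n" if "i \<in> K" for i
    proof -
      have "i \<le> \<Sum>K" using member_le_sum[of i K id] that K by (simp add: mono_sets_def)
      also have "\<dots> = nat n" using K by (auto simp: mono_sets_def simp del: of_nat_sum)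
      finally show ?thesis .
    qed
    then show "K \<in> Pow {..nat n}" by blast
  qed
qed simp

lemma triangle_sum: "(\<Sum>t<q. Suc t) = q * (q + 1) div 2"
  by (induction q) auto

lemma strict_nth_ge:
  assumes "sorted_wrt (<) (zs :: nat list)" "\<forall>z\<in>set zs. 2 \<le> z" "t < length zs"
  shows "t + 2 \<le> zs ! t"
  using assms(3)
proof (induction t)
  case 0
  then show ?case using assms(2)[rule_format, of "zs ! 0"] by simp
next
  case (Suc t)
  then have "zs ! t < zs ! Suc t" using assms(1) by (intro sorted_wrt_nth_less) auto
  with Suc show ?case by simp
qed

text \<open>Subtracting 1, \dots, q from the elements of a set in increasing order gives a partition.\<close>

lemma card_mono_sets: "card (mono_sets q (k + int (q * (q + 1) div 2))) = num_partitions q k"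
proof -
  let ?n = "k + int (q * (q + 1) div 2)"
  define P where "P = {xs :: nat list. length xs = q \<and> sorted xs \<and> (\<forall>x\<in>set xs. 1 \<le> x) \<and> int (sum_list xs) = k}"
  define Z where "Z = {zs :: nat list. length zs = q \<and> sorted_wrt (<) zs \<and> (\<forall>z\<in>set zs. 2 \<le> z) \<and> int (sum_list zs) = ?n}"
  define f where "f xs = map (\<lambda>t. xs ! t + Suc t) [0..<q]" for xs :: "nat list"
  define g where "g zs = map (\<lambda>t. zs ! t - Suc t) [0..<q]" for zs :: "nat list"
  have len: "length (f xs) = q" "length (g xs) = q" for xs
    by (simp_all add: f_def g_def)
  have sum_f: "sum_list (f xs) = sum_list xs + q * (q + 1) div 2" if "length xs = q" for xs
  proof -
    have "sum_list (f xs) = (\<Sum>t<q. xs ! t + Suc t)"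
      by (simp add: f_def sum_list_sum_nth atLeast0LessThan)
    also have "\<dots> = sum_list xs + (\<Sum>t<q. Suc t)"
      unfolding sum.distrib by (simp add: sum_list_sum_nth atLeast0LessThan that)
    finally show ?thesis unfolding triangle_sum .
  qed
  have gf: "g (f xs) = xs" if "length xs = q" for xs
    using that by (intro nth_equalityI) (auto simp: f_def g_def)
  have fg: "f (g zs) = zs" if "zs \<in> Z" for zs
  proof (rule nth_equalityI)
    fix t assume "t < length (f (g zs))"
    then have "t < q" by (simp add: len)
    \<comment> \<open>This bound makes the subtraction of t + 1 exact and leaves at least 1.\<close>
    moreover from this have "t + 2 \<le> zs ! t"
      using that strict_nth_ge[of zs t] by (auto simp: Z_def)
    ultimately show "f (g zs) ! t = zs ! t" by (simp add: f_def g_def)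
  qed (use that in \<open>simp add: len Z_def\<close>)
  have "bij_betw f P Z"
  proof (rule bij_betw_byWitness[where f' = g])
    show "f ` P \<subseteq> Z"
    proof
      fix zs assume "zs \<in> f ` P"
      then obtain xs where xs: "xs \<in> P" "zs = f xs" by blast
      have "sorted_wrt (<) zs"
        using xs by (auto simp: sorted_wrt_iff_nth_less f_def P_def
            intro!: add_le_less_mono sorted_nth_mono)
      moreover have "\<forall>z\<in>set zs. 2 \<le> z"
      proof
        fix z assume "z \<in> set zs"
        then obtain t where "t < q" "z = xs ! t + Suc t" using xs by (auto simp: f_def)
        moreover from this have "1 \<le> xs ! t" using xs nth_mem[of t xs] by (auto simp: P_def simp del: nth_mem)
        ultimately show "2 \<le> z" by simp
      qed
      ultimately show "zs \<in> Z" using xs sum_f[of xs] by (simp add: Z_def len P_def)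
    qed
    show "g ` Z \<subseteq> P"
    proof
      fix xs assume "xs \<in> g ` Z"
      then obtain zs where zs: "zs \<in> Z" "xs = g zs" by blast
      have "sorted xs"
        unfolding sorted_iff_nth_Suc
      proof (intro allI impI)
        fix t assume "Suc t < length xs"
        then have t: "Suc t < q" using zs by (simp add: len)
        then have "zs ! t < zs ! Suc t" using zs by (auto simp: Z_def intro: sorted_wrt_nth_less)
        then show "xs ! t \<le> xs ! Suc t" using t zs by (simp add: g_def)
      qed
      moreover have "\<forall>x\<in>set xs. 1 \<le> x"
      proof
        fix x assume "x \<in> set xs"
        then obtain t where "t < q" "x = zs ! t - Suc t" using zs by (auto simp: g_def)
        then show "1 \<le> x" using zs(1) strict_nth_ge[of zs t] by (auto simp: Z_def)
      qed
      moreover have "int (sum_list xs) = k"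
        using zs sum_f[of xs] fg[of zs] by (simp add: len Z_def)
      ultimately show "xs \<in> P" using zs by (simp add: P_def len)
    qed
  qed (auto simp: P_def gf fg)
  moreover have "bij_betw set Z (mono_sets q ?n)"
  proof (rule bij_betw_byWitness[where f' = sorted_list_of_set])
    show "\<forall>zs\<in>Z. sorted_list_of_set (set zs) = zs"
      by (auto simp: Z_def strict_sorted_iff sorted_list_of_set.idem_if_sorted_distinct)
    show "\<forall>K\<in>mono_sets q ?n. set (sorted_list_of_set K) = K"
      by (simp add: mono_sets_def)
    show "set ` Z \<subseteq> mono_sets q ?n"
      by (auto simp: Z_def mono_sets_def strict_sorted_iff distinct_card
          sum_list_distinct_conv_sum_set[of _ id, simplified] simp del: of_nat_sum)
    show "sorted_list_of_set ` mono_sets q ?n \<subseteq> Z"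
    proof
      fix zs assume "zs \<in> sorted_list_of_set ` mono_sets q ?n"
      then obtain K where K: "K \<in> mono_sets q ?n" "zs = sorted_list_of_set K" by blast
      then have "sum_list zs = \<Sum>K"
        using sum_list_distinct_conv_sum_set[of zs id] by (simp add: mono_sets_def)
      then show "zs \<in> Z"
        using K by (auto simp: Z_def mono_sets_def)
    qed
  qed
  ultimately have "card P = card (mono_sets q ?n)"
    using bij_betw_same_card bij_betw_trans by blast
  then show ?thesis by (simp add: num_partitions_def P_def)
qed

text \<open>Lowering the largest superscript keeps the elements distinct and at least 2 because it
  is not 2 and its predecessor is missing. Raising it always opens a gap, so the two operations are
  mutually inverse.\<close>

lemma card_not_top_pair:
  assumes q: "q \<ge> 1"
  shows "card {K \<in> mono_sets q n. \<not> top_pair K} = card (mono_sets q (n - 1))"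
proof -
  define f where "f K = insert (Max K - 1) (K - {Max K})" for K :: "nat set"
  define g where "g K = insert (Max K + 1) (K - {Max K})" for K :: "nat set"
  have K: "finite K" "K \<noteq> {}" "Max K \<in> K" "Max K \<ge> 2" "\<And>x. x \<in> K \<Longrightarrow> x \<le> Max K"
    "\<And>x. x \<in> K \<Longrightarrow> x \<ge> 2"
    if "K \<in> mono_sets q m" for K m
  proof -
    show 1: "finite K" "K \<noteq> {}" using that q by (auto simp: mono_sets_def)
    show 2: "Max K \<in> K" using Max_in[OF 1] .
    show "\<And>x. x \<in> K \<Longrightarrow> x \<ge> 2" "\<And>x. x \<in> K \<Longrightarrow> x \<le> Max K"
      using that 1 by (auto simp: mono_sets_def)
    then show "Max K \<ge> 2" using 2 by blast
  qed
  have sum: "\<Sum>K = Max K + \<Sum>(K - {Max K})" if "K \<in> mono_sets q m" for K m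
    using K[OF that] by (intro sum.remove)
  have f: "f K \<in> mono_sets q (n - 1) \<and> Max (f K) = Max K - 1 \<and> g (f K) = K"
    if "K \<in> mono_sets q n" "\<not> top_pair K" for K
  proof -
    note K = K[OF that(1)]
    have m: "Max K \<ge> 3" "Max K - 1 \<notin> K" using that(2) K(4) by (auto simp: top_pair_def)
    have le: "x \<le> Max K - 1" if "x \<in> K - {Max K}" for x
      using K(5)[of x] that by auto
    have max: "Max (f K) = Max K - 1"
      unfolding f_def using K(1) le by (intro Max_eqI) auto
    have "card (f K) = q" using K m that(1) q by (simp add: f_def mono_sets_def)
    moreover have "int (\<Sum>(f K)) = n - 1"
      using K m that(1) sum[OF that(1)]
      by (simp add: f_def mono_sets_def of_nat_diff del: of_nat_sum)
    ultimately have "f K \<in> mono_sets q (n - 1)" using K m by (auto simp: mono_sets_def f_def)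
    moreover have "f K - {Max K - 1} = K - {Max K}" using m by (auto simp: f_def)
    then have "g (f K) = K" unfolding g_def max using m K(3) by (simp add: insert_absorb)
    ultimately show ?thesis using max by blast
  qed
  have g: "g K \<in> {K \<in> mono_sets q n. \<not> top_pair K} \<and> f (g K) = K"
    if "K \<in> mono_sets q (n - 1)" for K
  proof -
    note K = K[OF that(1)]
    have n: "Max K + 1 \<notin> K" using K(5)[of "Max K + 1"] by auto
    have max: "Max (g K) = Max K + 1"
      unfolding g_def using K(1) by (intro Max_eqI) (auto intro: le_SucI K(5))
    have "card (g K) = q" using K n that(1) q by (simp add: g_def mono_sets_def)
    moreover have "int (\<Sum>(g K)) = n"
      using K n that(1) sum[OF that(1)] by (simp add: g_def mono_sets_def del: of_nat_sum)
    moreover have "g K \<subseteq> {2..}" using K(4,6) by (auto simp: g_def)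
    ultimately have "g K \<in> mono_sets q n" using K(1) by (simp add: mono_sets_def g_def)
    moreover have "\<not> top_pair (g K)"
      unfolding top_pair_def max using K(4) by (auto simp: g_def)
    moreover have "g K - {Max K + 1} = K - {Max K}" using n by (auto simp: g_def)
    then have "f (g K) = K" unfolding f_def max using K(3) by (simp add: insert_absorb)
    ultimately show ?thesis by blast
  qed
  have "bij_betw f {K \<in> mono_sets q n. \<not> top_pair K} (mono_sets q (n - 1))"
    by (rule bij_betw_byWitness[where f' = g]) (use f g in blast)+
  then show ?thesis by (rule bij_betw_same_card)
qed

lemma card_top_pair:
  assumes "q \<ge> 1"
  shows "int (card {K \<in> mono_sets q (k + int (q * (q + 1) div 2)). top_pair K}) =
    int (num_partitions q k) - int (num_partitions q (k - 1))"
proof -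
  let ?n = "k + int (q * (q + 1) div 2)"
  have "card (mono_sets q ?n) =
      card ({K \<in> mono_sets q ?n. top_pair K} \<union> {K \<in> mono_sets q ?n. \<not> top_pair K})"
    by (rule arg_cong[of _ _ card]) blast
  also have "\<dots> = card {K \<in> mono_sets q ?n. top_pair K} + card {K \<in> mono_sets q ?n. \<not> top_pair K}"
    by (rule card_Un_disjoint) (use finite_mono_sets[of q ?n] in auto)
  finally have "int (card (mono_sets q ?n)) = int (card {K \<in> mono_sets q ?n. top_pair K}) +
    int (card {K \<in> mono_sets q ?n. \<not> top_pair K})" by simp
  moreover have "?n - 1 = (k - 1) + int (q * (q + 1) div 2)" by simp
  then have "card (mono_sets q (?n - 1)) = num_partitions q (k - 1)"
    by (simp only: card_mono_sets)
  ultimately show ?thesis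
    using card_mono_sets[of q k] card_not_top_pair[OF assms, of ?n] by simp
qed

section \<open>A basis of the cohomology\<close>

text \<open>The added term makes the homotopy read \<open>a = omega_ext a + D1_inv (D1 a)\<close> in
  every positive degree and treats \<open>e 2\<close> like the other basis cocycles.\<close>

definition omega_ext :: "'k::field form \<Rightarrow> 'k form" where
  "omega_ext a = omega a + coeff a {2} *\<^sub>F e 2"

lemma omega_ext_linear: "omega_ext (a + b) = omega_ext a + omega_ext b"
  "omega_ext (c *\<^sub>F a) = c *\<^sub>F omega_ext a"
  by (simp_all add: omega_ext_def omega_add omega_scale form.scale_left_distrib
      form.scale_right_distrib)

lemma D1_omega_ext: "D1 (omega_ext a) = 0"
  by (simp add: omega_ext_def D1_add D1_scale D1_omega D1_e)

lemma d_omega_ext: "d (omega_ext a) = 0"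
  by (simp add: d_eq_D1 D1_omega_ext)

lemma omega_monom_in_Lam:
  assumes "finite I" "I \<noteq> {}" "0 \<notin> I"
  shows "omega (monom I * e (Max I + 1) :: 'k::field form) \<in> Lam (card I + 1) (int (\<Sum>I + (Max I + 1)))"
proof -
  have "D1_series (monom I) (Max I + 1) \<in> Lam (card I + 1) (int (\<Sum>I) + int (Max I + 1))"
    by (rule D1_series_in_Lam[OF monom_in_Lam])
  then show ?thesis using omega_monom[OF assms, where 'k = 'k] by (simp add: D1_series_def add_ac)
qed

lemma top_pair_cases:
  assumes "K \<in> mono_sets q n" "q \<ge> 1" "top_pair K"
  obtains "K = {2}" | I where "finite I" "I \<noteq> {}" "I \<subseteq> {2..}" "q = card I + 1"
    "n = int (\<Sum>I + (Max I + 1))" "monom K = (monom I * e (Max I + 1) :: 'k::field form)"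
proof -
  have K: "finite K" "K \<noteq> {}" "K \<subseteq> {2..}" "card K = q" "int (\<Sum>K) = n"
    using assms by (auto simp: mono_sets_def)
  have m: "Max K \<in> K" "\<And>x. x \<in> K \<Longrightarrow> x \<le> Max K" using K by auto
  define I where "I = K - {Max K}"
  show thesis
  proof (cases "Max K = 2")
    case True
    then have "K = {2}" using K m by (auto simp: subset_iff) (metis le_antisym)
    then show thesis by (rule that(1))
  next
    case False
    then have "Max K - 1 \<in> I" "Max K \<ge> 2" using assms(3) m K(3) by (auto simp: top_pair_def I_def)
    moreover have "x \<le> Max K - 1" if "x \<in> I" for x
      using that m(2)[of x] by (auto simp: I_def)
    ultimately have "Max I = Max K - 1" using K(1) by (intro Max_eqI) (auto simp: I_def)
    then have max: "Max I + 1 = Max K" using \<open>Max K \<ge> 2\<close> by simp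
    show thesis
    proof (rule that(2))
      show "I \<noteq> {}" using \<open>Max K - 1 \<in> I\<close> by blast
      show "q = card I + 1" using K m by (simp add: I_def card_Suc_Diff1 del: card_Diff_insert)
      have "\<Sum>K = Max K + \<Sum>I" unfolding I_def using K m by (intro sum.remove)
      then show "n = int (\<Sum>I + (Max I + 1))" unfolding max using K(5) by simp
      show "monom K = (monom I * e (Max I + 1) :: 'k form)"
        unfolding max unfolding I_def by (rule monom_remove_Max[OF K(1,2)])
    qed (use K in \<open>auto simp: I_def\<close>)
  qed
qed

lemma omega_ext_top_pair:
  assumes "finite I" "I \<noteq> {}"
  shows "omega_ext (monom I * e (Max I + 1)) = omega (monom I * e (Max I + 1) :: 'k::field form)"
proof -
  have "monom I * e (Max I + 1) = (monom (insert (Max I + 1) I) :: 'k form)"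
    using assms by (intro monom_insert_Max[symmetric]) (auto simp: less_Suc_eq_le)
  moreover have "insert (Max I + 1) I \<noteq> {2}"
  proof
    assume "insert (Max I + 1) I = {2}"
    then have "Max I + 1 = 2" "Max I = 2" using Max_in[OF assms] by auto
    then show False by simp
  qed
  ultimately show ?thesis by (auto simp: omega_ext_def coeff_monom)
qed

lemma omega_ext_top_pair_in_Lam:
  assumes "K \<in> mono_sets q n" "q \<ge> 1" "top_pair K"
  shows "omega_ext (monom K) \<in> (Lam q n :: 'k::field form set)"
  using assms
proof (cases rule: top_pair_cases[where 'k = 'k])
  case 1
  then show ?thesis
    using assms(1) e_in_Lam[of 2] by (auto simp: omega_ext_def omega_e2 coeff_monom mono_sets_def)
next
  case (2 I)
  then have "0 \<notin> I" by auto
  then show ?thesis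
    using omega_monom_in_Lam[OF 2(1,2), where 'k = 'k]
    unfolding 2(4-6) omega_ext_top_pair[OF 2(1,2)] by blast
qed

lemma omega_ext_not_top_pair:
  assumes "K \<in> mono_sets q n" "q \<ge> 1" "\<not> top_pair K"
  shows "omega_ext (monom K) = (0 :: 'k::field form)"
proof -
  have K: "finite K" "K \<noteq> {}" "K \<subseteq> {2..}"
    using assms by (auto simp: mono_sets_def)
  have m: "Max K \<in> K" "\<And>x. x \<in> K \<Longrightarrow> x \<le> Max K" using K by auto
  have "K - {Max K} \<subseteq> {..<Max K - 1}"
  proof
    fix x assume "x \<in> K - {Max K}"
    then have "x \<le> Max K" "x \<noteq> Max K" "x \<noteq> Max K - 1"
      using m assms(3) by (auto simp: top_pair_def)
    then show "x \<in> {..<Max K - 1}" by simp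
  qed
  then have "omega (monom (K - {Max K}) * e (Max K)) = (0 :: 'k form)"
    by (rule omega_eq_0_gap[OF monom_in_Lam_on])
  then have "omega (monom K) = (0 :: 'k form)"
    by (simp flip: monom_remove_Max[OF K(1,2)])
  moreover have "K \<noteq> {2}" using assms(3) by (auto simp: top_pair_def)
  then have "coeff (monom K :: 'k form) {2} = 0" by (auto simp: coeff_monom)
  ultimately show ?thesis by (simp add: omega_ext_def)
qed

lemma coeff_in_mono_sets:
  "a \<in> Lam_on {2..} q \<Longrightarrow> a \<in> Lam q n \<Longrightarrow> coeff a K \<noteq> 0 \<Longrightarrow> K \<in> mono_sets q n"
  unfolding in_Lam_on_iff in_Lam_iff mono_sets_def using coeff_infinite by blast

lemma cls_omega_ext_linear:
  "Vector_Spaces.linear scale_form scale_coh (\<lambda>a. cls (omega_ext a :: 'k::field form))"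
  by unfold_locales
    (simp_all add: omega_ext_linear cls_simps(1)[OF d_omega_ext d_omega_ext, symmetric]
      cls_simps(4)[OF d_omega_ext d_omega_ext, symmetric])

lemma cls_omega_ext_in_span:
  assumes a: "a \<in> Lam_on {2..} q" "a \<in> Lam q n" and q: "q \<ge> 1"
  shows "cls (omega_ext a) \<in> coh.span ((\<lambda>K. cls (omega_ext (monom K) :: 'k::field form)) `
    {K \<in> mono_sets q n. top_pair K})" (is "_ \<in> coh.span ?B")
proof -
  interpret l: Vector_Spaces.linear scale_form scale_coh "\<lambda>a. cls (omega_ext a :: 'k form)"
    by (rule cls_omega_ext_linear)
  have "cls (omega_ext a) = cls (omega_ext (\<Sum>I | coeff a I \<noteq> 0. coeff a I *\<^sub>F monom I))"
    by (simp flip: form_expand)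
  also have "\<dots> = (\<Sum>I | coeff a I \<noteq> 0. coeff a I *\<^sub>H cls (omega_ext (monom I)))"
    by (simp add: l.sum l.scale)
  also have "\<dots> \<in> coh.span ?B"
  proof (intro coh.span_sum coh.span_scale)
    fix K assume "K \<in> {I. coeff a I \<noteq> 0}"
    then have K: "K \<in> mono_sets q n" using a by (auto intro: coeff_in_mono_sets)
    show "cls (omega_ext (monom K)) \<in> coh.span ?B"
    proof (cases "top_pair K")
      case True
      with K show ?thesis by (intro coh.span_base) blast
    next
      case False
      with K q have "omega_ext (monom K) = (0 :: 'k form)" by (intro omega_ext_not_top_pair)
      then show ?thesis using coh.span_zero[of ?B] by (simp add: cls_01)
    qed
  qed
  finally show ?thesis .
qed

section \<open>Splitting off the factor \<open>e 1\<close>\<close>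

lemma e1_mult_coeff:
  assumes "x \<in> Lam_on {2..} q"
  shows "coeff (e 1 * x) K = (if 1 \<in> K then coeff x (K - {1}) else (0 :: 'k::field))"
  using assms
proof (induction rule: Lam_on_induct)
  case (monom I)
  have "e 1 * monom I = (monom (insert 1 I) :: 'k form)"
    using monom by (intro monom_insert_Min[symmetric]) auto
  moreover have "1 \<notin> I" "0 \<notin> I" using monom by auto
  then have "K = insert 1 I \<longleftrightarrow> 1 \<in> K \<and> K - {1} = I" by auto
  ultimately show ?case using monom \<open>0 \<notin> I\<close> by (simp add: coeff_monom)
qed (simp_all add: distrib_left)

lemma e1_mult_eq_0:
  assumes "x \<in> Lam_on {2..} q" "e 1 * x = 0"
  shows "x = (0 :: 'k::field form)"
proof (rule form_eqI)
  fix K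
  show "coeff x K = coeff 0 K"
  proof (cases "1 \<in> K")
    case True
    then show ?thesis using assms(1) by (force simp: in_Lam_on_iff)
  next
    case False
    then show ?thesis using e1_mult_coeff[OF assms(1), of "insert 1 K"] assms(2) by simp
  qed
qed

lemma Lam_split:
  assumes "a \<in> Lam q n" "q \<ge> 1"
  shows "\<exists>b c. a = b + e 1 * c \<and> b \<in> Lam_on {2..} q \<and> b \<in> Lam q n \<and>
    c \<in> Lam_on {2..} (q - 1) \<and> c \<in> (Lam (q - 1) (n - 1) :: 'k::field form set)"
  using assms(1) unfolding Lam_def[of q n]
proof (induction rule: form.span_induct_alt)
  case base
  show ?case by (intro exI[of _ 0]) (simp add: form.span_zero)
next
  case (step s x y)
  then obtain b c where y: "y = b + e 1 * c" "b \<in> Lam_on {2..} q" "b \<in> Lam q n"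
    "c \<in> Lam_on {2..} (q - 1)" "c \<in> (Lam (q - 1) (n - 1) :: 'k form set)"
    unfolding Lam_def[of q n] by blast
  from step obtain I where I: "x = monom I" "finite I" "I \<subseteq> {1..}" "card I = q" "int (\<Sum>I) = n"
    by blast
  have x: "\<exists>b c. x = b + e 1 * c \<and> b \<in> Lam_on {2..} q \<and> b \<in> Lam q n \<and>
    c \<in> Lam_on {2..} (q - 1) \<and> c \<in> (Lam (q - 1) (n - 1) :: 'k form set)"
  proof (cases "1 \<in> I")
    case True
    define J where "J = I - {1}"
    have "x = e 1 * monom J"
      unfolding I(1) using I True monom_insert_Min[of J 1, where 'k = 'k]
      by (force simp: J_def insert_absorb subset_iff)
    moreover have J: "J \<subseteq> {2..}" "card J = q - 1" using I True by (auto simp: J_def subset_iff)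
    moreover have "\<Sum>I = 1 + \<Sum>J" unfolding J_def using I True by (intro sum.remove)
    then have "int (\<Sum>J) = n - 1" using I(5) by simp
    ultimately show ?thesis
      using monom_in_Lam[of J, where 'a = 'k] monom_in_Lam_on[OF J(1), where 'a = 'k]
      by (intro exI[of _ 0] exI[of _ "monom J"]) simp
  next
    case False
    then have "I \<subseteq> {2..}" using I(3) by (auto simp: subset_iff Suc_le_eq) (metis One_nat_def Suc_lessI numeral_2_eq_2 Suc_leI)
    then show ?thesis
      using I monom_in_Lam[of I, where 'a = 'k] monom_in_Lam_on[of I "{2..}", where 'a = 'k]
      by (intro exI[of _ "monom I"] exI[of _ 0]) simp
  qed
  then obtain b' c' where x: "x = b' + e 1 * c'" "b' \<in> Lam_on {2..} q" "b' \<in> Lam q n"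
    "c' \<in> Lam_on {2..} (q - 1)" "c' \<in> (Lam (q - 1) (n - 1) :: 'k form set)"
    by blast
  show ?case unfolding Lam_def[of q n, symmetric]
    using x y by (intro exI[of _ "s *\<^sub>F b' + b"] exI[of _ "s *\<^sub>F c' + c"])
      (simp add: form.scale_right_distrib distrib_left Lam_add Lam_scale Lam_on_add Lam_on_scale)
qed

lemma Lam_0: "a \<in> Lam 0 n \<Longrightarrow> a = coeff a {} *\<^sub>F 1" "a \<in> Lam_on A 0 \<Longrightarrow> a = coeff a {} *\<^sub>F 1"
  by (rule form_eqI; force simp: in_Lam_iff in_Lam_on_iff one_form_def coeff_monom)+

text \<open>A cocycle is written as \<open>b + e 1 * c\<close> with \<open>b\<close>,
  \<open>c\<close> free of \<open>e 1\<close>. The second summand is closed, hence so is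
  \<open>b\<close>; as multiplication by \<open>e 1\<close> is injective on forms free of it,
  \<open>D1 b = 0\<close> and the homotopy gives \<open>omega_ext b = b\<close>. The form
  \<open>e 1 * c\<close> is exact unless \<open>c\<close> is a constant, and this happens only for q
  = 1.\<close>

lemma H_decompose:
  assumes "x \<in> H q n" "q \<ge> 1"
  obtains a s where "a \<in> Lam_on {2..} q" "a \<in> Lam q n" "x = cls (omega_ext a) + s *\<^sub>H cls (e 1)"
    "(q, n) \<noteq> (1, 1) \<Longrightarrow> s = (0 :: 'k::field)"
proof -
  obtain a where a: "a \<in> Lam q n" "d a = 0" "x = cls a" using assms(1) by (auto simp: H_def)
  obtain b c where bc: "a = b + e 1 * c" "b \<in> Lam_on {2..} q" "b \<in> Lam q n"
    "c \<in> Lam_on {2..} (q - 1)" "c \<in> (Lam (q - 1) (n - 1) :: 'k form set)"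
    using Lam_split[OF a(1) assms(2)] by blast
  have d1: "d (e 1 * y) = 0" for y :: "'k form"
    using e_square[of 1, where 'k = 'k] by (simp add: d_eq_D1 D1_mult D1_e mult.assoc[symmetric] del: One_nat_def)
  have "d b = 0" using a(2) d1[of c] by (simp add: bc(1) d_add)
  then have "e 1 * D1 b = 0" by (simp add: d_eq_D1)
  moreover have "D1 b \<in> Lam_on {2..} q" using bc(2) by (intro D1_Lam_on) auto
  ultimately have "D1 b = 0" using e1_mult_eq_0 by blast
  then have b: "omega_ext b = b"
    using D1_homotopy[OF bc(2) assms(2)] by (simp add: omega_ext_def)
  have x: "x = cls (omega_ext b) + cls (e 1 * c)"
    unfolding b a(3) bc(1) using \<open>d b = 0\<close> d1 by (simp add: cls_simps(1))
  have "\<exists>s. cls (e 1 * c) = s *\<^sub>H cls (e 1) \<and> ((q, n) \<noteq> (1, 1) \<longrightarrow> s = 0)"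
  proof (cases "q = 1")
    case True
    then have c: "c = coeff c {} *\<^sub>F 1" using bc(4) by (intro Lam_0(2)) simp
    have "coeff c {} = 0" if "n \<noteq> 1"
      using bc(5) that True by (auto simp: in_Lam_iff)
    moreover have "cls (e 1 * c) = coeff c {} *\<^sub>H cls (e 1)"
      using d1[of 1] by (subst c) (simp add: cls_simps)
    ultimately show ?thesis using True by auto
  next
    case False
    then have "e 1 * c = d (D1_inv c)"
      using D1_D1_inv[OF bc(4)] assms(2) by (simp add: d_eq_D1)
    then show ?thesis by (intro exI[of _ 0]) (simp add: cls_eq_0I)
  qed
  then obtain s where "cls (e 1 * c) = s *\<^sub>H cls (e 1)" "(q, n) \<noteq> (1, 1) \<Longrightarrow> s = 0" by blast
  with bc(2,3) x show thesis by (intro that[of b s]) simp_all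
qed

text \<open>The powers of \<open>D1\<close> keep the superscripts of \<open>a\<close> below m, while
  the last factor is e^(m+1+l): every monomial of the series has a gap below its largest
  superscript.\<close>

lemma coeff_D1_series_top_pair:
  assumes "a \<in> Lam_on {2..<m} q" "m \<ge> 2" "top_pair K"
  shows "coeff (D1_series a (m + 1)) K = (0 :: 'k::field)"
proof -
  have "\<forall>m\<ge>2. a \<in> Lam_on {2..<m} q \<longrightarrow> coeff (D1_series a (m + 1)) K = 0"
  proof (induction a rule: D1_induct)
    case (step a)
    show ?case
    proof (intro allI impI)
      fix m :: nat assume m: "m \<ge> 2" and a: "a \<in> Lam_on {2..<m} q"
      then have "D1 a \<in> Lam_on {2..<m} q" by (intro D1_Lam_on) auto
      \<comment> \<open>The bound on the superscripts is relaxed so that the induction hypothesis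
        applies with m + 1.\<close>
      then have "D1 a \<in> Lam_on {2..<m + 1} q" by (rule Lam_on_mono) auto
      then have "coeff (D1_series (D1 a) (m + 1 + 1)) K = 0" using step m by simp
      moreover have "coeff (a * e (m + 1)) K = 0"
      proof (rule ccontr)
        assume "coeff (a * e (m + 1)) K \<noteq> 0"
        then obtain I where I: "finite I" "I \<subseteq> {2..<m}" "K = insert (m + 1) I"
          using Lam_on_mult_e[OF a, of "m + 1" K] by auto
        have "Max K = m + 1" unfolding I(3) using I(1,2) by (intro Max_eqI) force+
        then show False using assms(3) I m by (auto simp: top_pair_def)
      qed
      ultimately show "coeff (D1_series a (m + 1)) K = 0"
        by (subst D1_series_rec) simp
    qed
  qed simp
  with assms show ?thesis by blast
qed

lemma coeff_D1_inv_top_pair: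
  assumes "a \<in> Lam_on {2..} q" "q \<ge> 1" "top_pair K"
  shows "coeff (D1_inv a) K = (0 :: 'k::field)"
  using assms(1,2)
proof (induction rule: Lam_on_pos_induct)
  case (monom I m)
  have "(monom I :: 'k form) \<in> Lam_on {2..<m} (card I)" using monom(2) by (rule monom_in_Lam_on)
  from D1_inv_mult_e[OF this monom(3)] coeff_D1_series_top_pair[OF this monom(3) assms(3)]
  show ?case by simp
qed (simp_all add: D1_inv_add D1_inv_scale)

text \<open>The span of the monomials with \<open>top_pair\<close> is mapped bijectively by the
  class of \<open>omega_ext\<close>. If \<open>omega_ext x\<close> is exact, then it and
  \<open>D1_inv (D1 x)\<close> both have coefficient 0 at all these monomials, and by the homotopy
  so does their sum \<open>x\<close>. In bidegree (1, 1) the class of \<open>e 1\<close> is not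
  reached.\<close>

lemma dim_H:
  assumes q: "q \<ge> 1" and qn: "(q, n) \<noteq> (1, 1)"
  shows "coh.dim (H q n :: 'k::field coh set) = card {K \<in> mono_sets q n. top_pair K}"
proof -
  let ?C = "{K \<in> mono_sets q n. top_pair K}"
  let ?f = "\<lambda>a. cls (omega_ext a :: 'k form)"
  interpret l: Vector_Spaces.linear scale_form scale_coh ?f
    by (rule cls_omega_ext_linear)
  have span: "form.span (monom ` ?C) = {a :: 'k form. \<forall>K. coeff a K \<noteq> 0 \<longrightarrow> K \<in> ?C}"
    using span_monom[of "\<lambda>K. K \<in> ?C", where 'k = 'k] by (simp add: setcompr_eq_image)
  have inj_monom: "inj_on (monom :: nat set \<Rightarrow> 'k form) ?C"
  proof (rule inj_onI)
    fix I J assume IJ: "I \<in> ?C" "J \<in> ?C" "monom I = (monom J :: 'k form)"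
    then have "coeff (monom I :: 'k form) I = coeff (monom J) I" by simp
    moreover have "finite I" "0 \<notin> I" using IJ by (auto simp: mono_sets_def)
    ultimately show "I = J" by (auto simp: coeff_monom split: if_splits)
  qed
  have indep: "form.independent (monom ` ?C :: 'k form set)"
    unfolding form.dependent_def
  proof
    assume "\<exists>a\<in>monom ` ?C. a \<in> form.span (monom ` ?C - {a :: 'k form})"
    then obtain I where I: "I \<in> ?C" "monom I \<in> form.span (monom ` ?C - {monom I :: 'k form})" by blast
    have "monom ` ?C - {monom I :: 'k form} \<subseteq> {monom J | J. J \<noteq> I}" by auto
    then have "monom I \<in> form.span {monom J :: 'k form | J. J \<noteq> I}" using I(2) form.span_mono by blast
    then have "coeff (monom I :: 'k form) I = 0" unfolding span_monom by blast
    moreover have "finite I" "0 \<notin> I" using I(1) by (auto simp: mono_sets_def)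
    ultimately show False by (simp add: coeff_monom)
  qed
  have inj: "inj_on ?f (form.span (monom ` ?C))"
    unfolding l.inj_on_iff_eq_0[OF form.subspace_span]
  proof (intro ballI impI)
    fix x :: "'k form" assume x: "x \<in> form.span (monom ` ?C)" and 0: "?f x = 0"
    have supp: "K \<in> ?C" if "coeff x K \<noteq> 0" for K using x that unfolding span by blast
    have xL: "x \<in> Lam_on {2..} q"
      unfolding in_Lam_on_iff using supp by (auto simp: mono_sets_def)
    have D: "D1 x \<in> Lam_on {2..} q" using xL by (intro D1_Lam_on) auto
    have hom: "omega_ext x + D1_inv (D1 x) = x"
      using D1_homotopy[OF xL q] by (simp add: omega_ext_def)
    obtain y where y: "omega_ext x = d y"
      using 0 cls_eq_iff[of "omega_ext x" 0] by (auto simp: d_omega_ext cls_01)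
    \<comment> \<open>Exact forms are multiples of \<open>e 1\<close>, so they have no coefficient
      at a monomial without the superscript 1.\<close>
    have cy: "coeff (e 1 * z) K = 0" if "1 \<notin> K" for z :: "'k form" and K
      unfolding coeff_times using that by (intro sum.neutral) (auto simp: coeff_monom)
    show "x = 0"
    proof (rule form_eqI)
      fix K :: "nat set"
      show "coeff x K = coeff 0 K"
      proof (cases "K \<in> ?C")
        case True
        then have "1 \<notin> K" by (auto simp: mono_sets_def)
        then have "coeff (omega_ext x) K = 0" unfolding y d_eq_D1 by (rule cy)
        moreover have "coeff (D1_inv (D1 x)) K = 0"
          using D q True by (intro coeff_D1_inv_top_pair) auto
        ultimately show ?thesis using hom coeff_add[of "omega_ext x" "D1_inv (D1 x)" K] by simp
      qed (use supp in auto)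
    qed
  qed
  have "card (?f ` monom ` ?C) = card ?C"
    using inj_on_subset[OF inj form.span_superset] inj_monom by (simp add: card_image)
  moreover have "coh.independent (?f ` monom ` ?C)"
    by (rule l.independent_injective_image[OF indep inj])
  moreover have "?f ` monom ` ?C \<subseteq> H q n"
    unfolding H_def using omega_ext_top_pair_in_Lam q d_omega_ext by blast
  moreover have "H q n \<subseteq> coh.span (?f ` monom ` ?C)"
  proof
    fix x :: "'k coh" assume "x \<in> H q n"
    then show "x \<in> coh.span (?f ` monom ` ?C)"
      by (rule H_decompose[OF _ q]) (use cls_omega_ext_in_span[OF _ _ q, of _ n] qn in \<open>auto simp: image_image\<close>)
  qed
  ultimately show ?thesis by (intro coh.dim_unique) auto
qed

text \<open>Each \<open>H q n\<close> is treated separately. Degree 0 consists of constants, for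
  which the unit is listed; in positive degree the cocycles come from
  \<open>H_decompose\<close>.\<close>

lemma span_cocycles:
  "coh.span ({1, cls (e 1), cls (e 2)} \<union>
     {cls (omega (monom I * e (Max I + 1))) | I. finite I \<and> I \<noteq> {} \<and> I \<subseteq> {2..}})
    = (UNIV :: 'k::field coh set)" (is "coh.span ?G = _")
proof -
  have "H q n \<subseteq> coh.span ?G" for q n
  proof
    fix x :: "'k coh" assume x: "x \<in> H q n"
    show "x \<in> coh.span ?G"
    proof (cases "q \<ge> 1")
      case False
      then have "q = 0" by simp
      with x obtain a where a: "a \<in> Lam 0 n" "d a = 0" "x = cls a" unfolding H_def by blast
      then have "x = coeff a {} *\<^sub>H 1"
        using Lam_0(1)[OF a(1)] cls_simps(4)[of 1 1 "coeff a {}"] by (simp add: cls_01)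
      then show ?thesis by (auto intro: coh.span_scale coh.span_base)
    next
      case q: True
      obtain a s where as: "a \<in> Lam_on {2..} q" "a \<in> Lam q n" "x = cls (omega_ext a) + s *\<^sub>H cls (e 1)"
        using H_decompose[OF x q] by blast
      have "(\<lambda>K. cls (omega_ext (monom K))) ` {K \<in> mono_sets q n. top_pair K} \<subseteq> ?G"
      proof (intro image_subsetI)
        fix K assume "K \<in> {K \<in> mono_sets q n. top_pair K}"
        then have K: "K \<in> mono_sets q n" "top_pair K" by auto
        from K(1) q K(2) show "cls (omega_ext (monom K)) \<in> ?G"
        proof (cases rule: top_pair_cases[where 'k = 'k])
          case 1
          then show ?thesis by (simp add: omega_ext_def omega_e2 coeff_monom)
        next
          case (2 I)
          then show ?thesis using omega_ext_top_pair[of I, where 'k = 'k] by auto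
        qed
      qed
      then have "cls (omega_ext a) \<in> coh.span ?G"
        using cls_omega_ext_in_span[OF as(1,2) q] coh.span_mono by blast
      moreover have "s *\<^sub>H cls (e 1) \<in> coh.span ?G" by (intro coh.span_scale coh.span_base) simp
      ultimately show ?thesis unfolding as(3) by (rule coh.span_add)
    qed
  qed
  then have "coh.span (\<Union>q n. H q n) \<subseteq> coh.span ?G"
    by (intro coh.span_minimal coh.subspace_span) blast
  then show ?thesis unfolding span_H by blast
qed

text \<open>The unit is among the generators because it spans degree 0. The pair q = 1, k = 0 is
  excluded: \<open>e 1\<close> spans cohomology in bidegree (1, 1), whereas the difference of
  partition numbers is 0 there. The exponent j - i + s - 1 has this order so that natural
  subtraction is exact for i = j.\<close>

theorem theorem3p4:
  shows
    "(e 1 :: 'k::field_char_0 form) \<in> Lam 1 1 \<and> d (e 1 :: 'k form) = 0 \<and>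
     (e 2 :: 'k form) \<in> Lam 1 2 \<and> d (e 2 :: 'k form) = 0 \<and>
     (\<forall>I. finite I \<and> I \<noteq> {} \<and> I \<subseteq> {2..} \<longrightarrow>
        omega (monom I * e (Max I + 1) :: 'k form) =
          Sum_any (\<lambda>l. (-1) ^ l * (D1 ^^ l) (monom I) * e (Max I + 1 + l)) \<and>
        omega (monom I * e (Max I + 1) :: 'k form) \<in>
          Lam (card I + 1) (int (\<Sum>I + (Max I + 1))) \<and>
        d (omega (monom I * e (Max I + 1) :: 'k form)) = 0) \<and>
     coh.span ({1, cls (e 1), cls (e 2)} \<union>
        {cls (omega (monom I * e (Max I + 1))) | I. finite I \<and> I \<noteq> {} \<and> I \<subseteq> {2..}})
       = (UNIV :: 'k coh set) \<and>
     (\<forall>q k. q \<ge> 1 \<and> \<not> (q = 1 \<and> k = 0) \<longrightarrow>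
        int (coh.dim (H q (k + int (q * (q + 1) div 2)) :: 'k coh set)) =
          int (num_partitions q k) - int (num_partitions q (k - 1))) \<and>
     (\<forall>i p (\<xi> :: 'k form). 2 \<le> i \<and> \<xi> \<in> Lam_on {2..i - 1} p \<longrightarrow>
        cls (e 1) * cls (omega (\<xi> * e i * e (i + 1))) = 0 \<and>
        cls (e 2) * cls (omega (\<xi> * e i * e (i + 1))) = cls (omega (e 2 * \<xi> * e i * e (i + 1)))) \<and>
     (\<forall>i j p r (\<xi> :: 'k form) \<eta>. 2 \<le> i \<and> i \<le> j \<and>
        \<xi> \<in> Lam_on {2..i - 1} p \<and> \<eta> \<in> Lam_on {2..j - 1} r \<longrightarrow>
        cls (omega (\<xi> * e i * e (i + 1))) * cls (omega (\<eta> * e j * e (j + 1))) =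
          (\<Sum>l = 0..j - i + 1. (-1) ^ l *
             cls (omega ((D1 ^^ l) (\<xi> * e i) * e (i + 1 + l) * \<eta> * e j * e (j + 1)))) +
          (-1) ^ (j - i + r) * Sum_any (\<lambda>s. if s \<ge> 1 then
             cls (omega ((D1 ^^ (j - i + s - 1)) (\<xi> * e i) * (D1 ^^ s) (\<eta> * e j) *
               e (j + s) * e (j + s + 1))) else 0) +
          (-1) ^ (j - i + r + 1) * Sum_any (\<lambda>s. if s \<ge> 1 then
             cls (omega ((D1 ^^ (j - i + 1 + s)) (\<xi> * e i) * (D1 ^^ s) (\<eta> * e j) *
               e (j + s + 1) * e (j + s + 2))) else 0))"
proof (intro conjI)
  show "e 1 \<in> (Lam 1 1 :: 'k form set)" "e 2 \<in> (Lam 1 2 :: 'k form set)"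
    using e_in_Lam[of 1, where 'a = 'k] e_in_Lam[of 2, where 'a = 'k] by simp_all
  show "d (e 1) = (0 :: 'k form)" "d (e 2) = (0 :: 'k form)" by (rule d_e)+
next
  show "\<forall>I. finite I \<and> I \<noteq> {} \<and> I \<subseteq> {2..} \<longrightarrow>
        omega (monom I * e (Max I + 1) :: 'k form) =
          Sum_any (\<lambda>l. (-1) ^ l * (D1 ^^ l) (monom I) * e (Max I + 1 + l)) \<and>
        omega (monom I * e (Max I + 1) :: 'k form) \<in>
          Lam (card I + 1) (int (\<Sum>I + (Max I + 1))) \<and>
        d (omega (monom I * e (Max I + 1) :: 'k form)) = 0"
  proof (intro allI impI)
    fix I :: "nat set" assume "finite I \<and> I \<noteq> {} \<and> I \<subseteq> {2..}"
    then have I: "finite I" "I \<noteq> {}" "0 \<notin> I" by auto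
    show "omega (monom I * e (Max I + 1) :: 'k form) =
          Sum_any (\<lambda>l. (-1) ^ l * (D1 ^^ l) (monom I) * e (Max I + 1 + l)) \<and>
        omega (monom I * e (Max I + 1) :: 'k form) \<in>
          Lam (card I + 1) (int (\<Sum>I + (Max I + 1))) \<and>
        d (omega (monom I * e (Max I + 1) :: 'k form)) = 0"
      by (intro conjI omega_monom omega_monom_in_Lam d_omega I)
  qed
next
  show "coh.span ({1, cls (e 1), cls (e 2)} \<union>
        {cls (omega (monom I * e (Max I + 1))) | I. finite I \<and> I \<noteq> {} \<and> I \<subseteq> {2..}})
       = (UNIV :: 'k coh set)"
    by (rule span_cocycles)
next
  show "\<forall>q k. q \<ge> 1 \<and> \<not> (q = 1 \<and> k = 0) \<longrightarrow>
        int (coh.dim (H q (k + int (q * (q + 1) div 2)) :: 'k coh set)) =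
          int (num_partitions q k) - int (num_partitions q (k - 1))"
  proof (intro allI impI)
    fix q :: nat and k :: int assume "q \<ge> 1 \<and> \<not> (q = 1 \<and> k = 0)"
    then have q: "q \<ge> 1" "(q, k + int (q * (q + 1) div 2)) \<noteq> (1, 1)" by auto
    show "int (coh.dim (H q (k + int (q * (q + 1) div 2)) :: 'k coh set)) =
          int (num_partitions q k) - int (num_partitions q (k - 1))"
      unfolding dim_H[OF q] by (rule card_top_pair[OF q(1)])
  qed
next
  show "\<forall>i p (\<xi> :: 'k form). 2 \<le> i \<and> \<xi> \<in> Lam_on {2..i - 1} p \<longrightarrow>
        cls (e 1) * cls (omega (\<xi> * e i * e (i + 1))) = 0 \<and>
        cls (e 2) * cls (omega (\<xi> * e i * e (i + 1))) = cls (omega (e 2 * \<xi> * e i * e (i + 1)))"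
  proof (intro allI impI, elim conjE)
    fix i p and \<xi> :: "'k form" assume i: "2 \<le> i" and \<xi>: "\<xi> \<in> Lam_on {2..i - 1} p"
    have "cls (e 1) * cls (omega (\<xi> * e i * e (i + 1))) = 0"
      by (rule cls_e1_mult[OF omega_in_Lam_on[OF \<xi> i]]) (simp_all add: D1_omega)
    moreover have "cls (e 2) * cls (omega (\<xi> * e i * e (i + 1))) =
        cls (e 2 * omega (\<xi> * e i * e (i + 1)))"
      by (rule cls_simps(3)) (rule d_e d_omega)+
    ultimately show "cls (e 1) * cls (omega (\<xi> * e i * e (i + 1))) = 0 \<and>
        cls (e 2) * cls (omega (\<xi> * e i * e (i + 1))) = cls (omega (e 2 * \<xi> * e i * e (i + 1)))"
      by (simp only: e2_mult_omega[OF \<xi> i] simp_thms)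
  qed
qed (use cls_omega_mult in blast)

end
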